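(* Let $F$ be any bivariate distribution function with support contained in $[0,\infty)^2$. Then, for any fixed scaling factors $a_1>0$, $a_2>0$, there exists a sequence of bivariate common-shock phase-type (CSPH) distributions with these scaling factors that converges weakly to $F$.
   Context: CSPH distribution. Let $\mathcal{E}$ (pre-shock states) and $\mathcal{S}$ (post-shock states) be disjoint finite nonempty sets (of arbitrary sizes). The parameters are: a row probability vector $\boldsymbol{\alpha}$ on $\mathcal{E}$; a subintensity matrix $\mathbf{T}$ on $\mathcal{E}$; an entrywise nonnegative $|\mathcal{E}|\times|\mathcal{S}|$ matrix $\mathbf{U}$ with $\mathbf{T}\mathbf{1}+\mathbf{U}\mathbf{1}=\mathbf{0}$, where $\mathbf{1}$ is a column vector of ones; subintensity matrices $\mathbf{Q}_1,\mathbf{Q}_2$ on $\mathcal{S}$; and scaling factors $a_1,a_2>0$. A subintensity matrix is a square real matrix with nonpositive diagonal entries, nonnegative off-diagonal entries and nonpositive row sums. All states of $\mathcal{E}$ are transient for $\mathbf{T}$ and all states of $\mathcal{S}$ are transient for $\mathbf{Q}_1$ and for $\mathbf{Q}_2$ (equivalently, $\mathbf{T},\mathbf{Q}_1,\mathbf{Q}_2$ are nonsingular), so all times below are almost surely finite. A continuous-time Markov jump process starts in $\mathcal{E}$ with initial distribution $\boldsymbol{\alpha}$, moves within $\mathcal{E}$ with rates $\mathbf{T}$ and jumps from $\mathcal{E}$ to $\mathcal{S}$ with rates $\mathbf{U}$. Let $\tau_{1,2}$ be the exit time from $\mathcal{E}$ (the common-shock time) and $K\in\mathcal{S}$ the state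 entered at that time. After $\tau_{1,2}$, two processes $J_1,J_2$ start from $K$ and evolve on $\mathcal{S}$ independently of each other (and, given $K$, of $\tau_{1,2}$), as Markov jump processes with subintensity matrices $\mathbf{Q}_1$ and $\mathbf{Q}_2$ respectively, until absorption into a state outside $\mathcal{E}\cup\mathcal{S}$; $\tilde\tau_i$ is the time $J_i$ spends in $\mathcal{S}$. The law of $(X_1,X_2)$ with $X_i=a_i\tau_{1,2}+\tilde\tau_i$ is called the CSPH distribution with parameters $(\boldsymbol{\alpha},\mathbf{T},\mathbf{U},\mathbf{Q}_1,\mathbf{Q}_2,a_1,a_2)$; $a_1,a_2$ are its scaling factors. *)

theory Defs
  imports "HOL-Probability.Probability"
begin

text \<open>Vectors and matrices indexed by finite sets of states are functions; only their values on
  the index sets matter.\<close>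

definition probability_vector :: "'s set \<Rightarrow> ('s \<Rightarrow> real) \<Rightarrow> bool" where
  "probability_vector I v \<longleftrightarrow> (\<forall>i\<in>I. 0 \<le> v i) \<and> (\<Sum>i\<in>I. v i) = 1"

definition subintensity_matrix :: "'s set \<Rightarrow> ('s \<Rightarrow> 's \<Rightarrow> real) \<Rightarrow> bool" where
  "subintensity_matrix I Q \<longleftrightarrow>
     (\<forall>i\<in>I. Q i i \<le> 0) \<and>
     (\<forall>i\<in>I. \<forall>j\<in>I. i \<noteq> j \<longrightarrow> 0 \<le> Q i j) \<and>
     (\<forall>i\<in>I. (\<Sum>j\<in>I. Q i j) \<le> 0)"

text \<open>For a subintensity matrix on a finite set, nonsingularity says that all states are
  transient.\<close>

definition nonsingular_on :: "'s set \<Rightarrow> ('s \<Rightarrow> 's \<Rightarrow> real) \<Rightarrow> bool" where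
  "nonsingular_on I Q \<longleftrightarrow>
     (\<forall>v. (\<forall>i\<in>I. (\<Sum>j\<in>I. Q i j * v j) = 0) \<longrightarrow> (\<forall>i\<in>I. v i = 0))"

text \<open>Transition matrix of the embedded jump chain of an intensity matrix; states with
  exit rate zero are absorbing.\<close>

definition jump_matrix :: "('s \<Rightarrow> 's \<Rightarrow> real) \<Rightarrow> 's \<Rightarrow> 's \<Rightarrow> real" where
  "jump_matrix L i j =
     (if L i i = 0 then (if j = i then 1 else 0)
      else (if j = i then 0 else L i j / (- L i i)))"

text \<open>Markov jump process on the finite set \<open>I\<close> with initial distribution \<open>p\<close> and intensity
  matrix \<open>L\<close>, in the jump chain / holding time form: \<open>Y\<close> is the sequence of visited states,
  a Markov chain with transition matrix \<open>jump_matrix L\<close>, and given \<open>Y\<close> the holding times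
  \<open>H n\<close> are independent and exponential with rates \<open>- L (Y n) (Y n)\<close>. The product formula is
  the joint law of \<open>(Y 0, H 0), \<dots>, (Y n, H n)\<close>; holding times at rate zero are
  almost surely infinite, so they take values in \<^typ>\<open>ennreal\<close>.\<close>

definition markov_jump_process ::
  "'w measure \<Rightarrow> 's set \<Rightarrow> ('s \<Rightarrow> real) \<Rightarrow> ('s \<Rightarrow> 's \<Rightarrow> real) \<Rightarrow> (real \<Rightarrow> 'w \<Rightarrow> 's) \<Rightarrow> bool" where
  "markov_jump_process M I p L X \<longleftrightarrow>
     prob_space M \<and> finite I \<and>
     (\<forall>t\<ge>0. X t \<in> M \<rightarrow>\<^sub>M count_space I) \<and>
     (\<exists>(Y :: nat \<Rightarrow> 'w \<Rightarrow> 's) (H :: nat \<Rightarrow> 'w \<Rightarrow> ennreal).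
        (\<forall>n. Y n \<in> M \<rightarrow>\<^sub>M count_space I) \<and>
        (\<forall>n. H n \<in> borel_measurable M) \<and>
        (\<forall>n (i :: nat \<Rightarrow> 's) (t :: nat \<Rightarrow> real). (\<forall>m\<le>n. i m \<in> I \<and> 0 \<le> t m) \<longrightarrow>
           measure M {\<omega> \<in> space M. \<forall>m\<le>n. Y m \<omega> = i m \<and> ennreal (t m) < H m \<omega>} =
             p (i 0) * (\<Prod>m<n. jump_matrix L (i m) (i (Suc m)))
                     * (\<Prod>m\<le>n. exp (L (i m) (i m) * t m))) \<and>
        (AE \<omega> in M. \<forall>t\<ge>0. \<forall>n.
           (\<Sum>m<n. H m \<omega>) \<le> ennreal t \<and> ennreal t < (\<Sum>m\<le>n. H m \<omega>) \<longrightarrow> X t \<omega> = Y n \<omega>))"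

definition exit_time :: "(real \<Rightarrow> 'w \<Rightarrow> 's) \<Rightarrow> 's set \<Rightarrow> 'w \<Rightarrow> real" where
  "exit_time X A \<omega> = Inf {t. 0 \<le> t \<and> X t \<omega> \<notin> A}"

text \<open>Intensities on \<open>E \<union> S\<close> of the process run until the common shock: block rows
  \<open>(T, U)\<close> and \<open>(0, 0)\<close>.\<close>

definition shock_intensity ::
  "'s set \<Rightarrow> 's set \<Rightarrow> ('s \<Rightarrow> 's \<Rightarrow> real) \<Rightarrow> ('s \<Rightarrow> 's \<Rightarrow> real) \<Rightarrow> 's \<Rightarrow> 's \<Rightarrow> real" where
  "shock_intensity E S T U i j =
     (if i \<in> E then (if j \<in> E then T i j else if j \<in> S then U i j else 0) else 0)"

text \<open>Extension of a subintensity matrix on \<open>S\<close> by the absorbing state \<^term>\<open>None\<close>.\<close>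

definition absorbing_states :: "'s set \<Rightarrow> 's option set" where
  "absorbing_states S = insert None (Some ` S)"

fun absorbing_intensity ::
  "'s set \<Rightarrow> ('s \<Rightarrow> 's \<Rightarrow> real) \<Rightarrow> 's option \<Rightarrow> 's option \<Rightarrow> real" where
  "absorbing_intensity S Q (Some i) (Some j) = Q i j"
| "absorbing_intensity S Q (Some i) None = - (\<Sum>j\<in>S. Q i j)"
| "absorbing_intensity S Q None _ = 0"

definition process_events :: "'w measure \<Rightarrow> (real \<Rightarrow> 'w \<Rightarrow> 's) \<Rightarrow> 'w set set" where
  "process_events M X = sigma_sets (space M) {X t -` A \<inter> space M | t A. 0 \<le> t}"

definition variable_events :: "'w measure \<Rightarrow> ('w \<Rightarrow> real) \<Rightarrow> 'w set set" where
  "variable_events M X = {X -` A \<inter> space M | A. A \<in> sets borel}"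

definition csph_parameters ::
  "'s set \<Rightarrow> 's set \<Rightarrow> ('s \<Rightarrow> real) \<Rightarrow> ('s \<Rightarrow> 's \<Rightarrow> real) \<Rightarrow> ('s \<Rightarrow> 's \<Rightarrow> real) \<Rightarrow>
   ('s \<Rightarrow> 's \<Rightarrow> real) \<Rightarrow> ('s \<Rightarrow> 's \<Rightarrow> real) \<Rightarrow> real \<Rightarrow> real \<Rightarrow> bool" where
  "csph_parameters E S \<alpha> T U Q1 Q2 a1 a2 \<longleftrightarrow>
     finite E \<and> E \<noteq> {} \<and> finite S \<and> S \<noteq> {} \<and> E \<inter> S = {} \<and>
     probability_vector E \<alpha> \<and>
     subintensity_matrix E T \<and> nonsingular_on E T \<and>
     (\<forall>i\<in>E. \<forall>k\<in>S. 0 \<le> U i k) \<and>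
     (\<forall>i\<in>E. (\<Sum>j\<in>E. T i j) + (\<Sum>k\<in>S. U i k) = 0) \<and>
     subintensity_matrix S Q1 \<and> nonsingular_on S Q1 \<and>
     subintensity_matrix S Q2 \<and> nonsingular_on S Q2 \<and>
     0 < a1 \<and> 0 < a2"

text \<open>\<open>J\<close> is the process up to the common shock, at time \<open>\<tau> = exit_time J E\<close> and in state
  \<open>K\<close>; \<open>J1\<close> and \<open>J2\<close> are the processes after the shock, with time measured from the shock.
  Conditioning on \<open>K = k\<close> is expressed by \<^const>\<open>uniform_measure\<close>. Since paths are only
  prescribed almost surely, measurability of \<open>K\<close> and of the exit times is required
  explicitly.\<close>

definition csph_construction ::
  "'w measure \<Rightarrow> (real \<Rightarrow> 'w \<Rightarrow> 's) \<Rightarrow> (real \<Rightarrow> 'w \<Rightarrow> 's option) \<Rightarrow> (real \<Rightarrow> 'w \<Rightarrow> 's option) \<Rightarrow>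
   's set \<Rightarrow> 's set \<Rightarrow> ('s \<Rightarrow> real) \<Rightarrow> ('s \<Rightarrow> 's \<Rightarrow> real) \<Rightarrow> ('s \<Rightarrow> 's \<Rightarrow> real) \<Rightarrow>
   ('s \<Rightarrow> 's \<Rightarrow> real) \<Rightarrow> ('s \<Rightarrow> 's \<Rightarrow> real) \<Rightarrow> bool" where
  "csph_construction M J J1 J2 E S \<alpha> T U Q1 Q2 \<longleftrightarrow>
     (let \<tau> = exit_time J E;
          K = (\<lambda>\<omega>. J (\<tau> \<omega>) \<omega>)
      in markov_jump_process M (E \<union> S) (\<lambda>i. if i \<in> E then \<alpha> i else 0) (shock_intensity E S T U) J \<and>
         \<tau> \<in> borel_measurable M \<and>
         K \<in> M \<rightarrow>\<^sub>M count_space (E \<union> S) \<and>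
         exit_time J1 (Some ` S) \<in> borel_measurable M \<and>
         exit_time J2 (Some ` S) \<in> borel_measurable M \<and>
         (\<forall>k\<in>S. measure M {\<omega> \<in> space M. K \<omega> = k} > 0 \<longrightarrow>
            (let N = uniform_measure M {\<omega> \<in> space M. K \<omega> = k};
                 \<delta> = (\<lambda>x. if x = Some k then 1 else 0)
             in markov_jump_process N (absorbing_states S) \<delta> (absorbing_intensity S Q1) J1 \<and>
                markov_jump_process N (absorbing_states S) \<delta> (absorbing_intensity S Q2) J2 \<and>
                prob_space.indep_sets N
                  (\<lambda>n::nat. if n = 0 then variable_events N \<tau>
                            else if n = 1 then process_events N J1
                            else process_events N J2)
                  {0, 1, 2})))"

text \<open>\<open>\<mu>\<close> is the CSPH distribution with the given parameters. The sample space type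
  \<^typ>\<open>nat \<Rightarrow> real\<close> is no restriction: the processes are functions of countably many real random
  variables (jump chains and holding times).\<close>

definition csph_law ::
  "'s set \<Rightarrow> 's set \<Rightarrow> ('s \<Rightarrow> real) \<Rightarrow> ('s \<Rightarrow> 's \<Rightarrow> real) \<Rightarrow> ('s \<Rightarrow> 's \<Rightarrow> real) \<Rightarrow>
   ('s \<Rightarrow> 's \<Rightarrow> real) \<Rightarrow> ('s \<Rightarrow> 's \<Rightarrow> real) \<Rightarrow> real \<Rightarrow> real \<Rightarrow> (real \<times> real) measure \<Rightarrow> bool" where
  "csph_law E S \<alpha> T U Q1 Q2 a1 a2 \<mu> \<longleftrightarrow>
     (\<exists>(M :: (nat \<Rightarrow> real) measure) J J1 J2.
        csph_construction M J J1 J2 E S \<alpha> T U Q1 Q2 \<and>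
        \<mu> = distr M borel
              (\<lambda>\<omega>. (a1 * exit_time J E \<omega> + exit_time J1 (Some ` S) \<omega>,
                    a2 * exit_time J E \<omega> + exit_time J2 (Some ` S) \<omega>)))"

text \<open>The states may be taken to be natural numbers, as state spaces are finite.\<close>

definition csph_distribution :: "real \<Rightarrow> real \<Rightarrow> (real \<times> real) measure \<Rightarrow> bool" where
  "csph_distribution a1 a2 \<mu> \<longleftrightarrow>
     (\<exists>(E :: nat set) S \<alpha> T U Q1 Q2.
        csph_parameters E S \<alpha> T U Q1 Q2 a1 a2 \<and> csph_law E S \<alpha> T U Q1 Q2 a1 a2 \<mu>)"

definition bivariate_cdf :: "(real \<times> real) measure \<Rightarrow> real \<times> real \<Rightarrow> real" where
  "bivariate_cdf \<mu> = (\<lambda>(x, y). measure \<mu> ({..x} \<times> {..y}))"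

definition support :: "'a::topological_space measure \<Rightarrow> 'a set" where
  "support \<mu> = {z. \<forall>V. open V \<longrightarrow> z \<in> V \<longrightarrow> 0 < measure \<mu> V}"

text \<open>Bivariate analogue of \<^const>\<open>weak_conv\<close>.\<close>

definition bivariate_weak_conv ::
  "(nat \<Rightarrow> real \<times> real \<Rightarrow> real) \<Rightarrow> (real \<times> real \<Rightarrow> real) \<Rightarrow> bool" where
  "bivariate_weak_conv Fs F \<longleftrightarrow> (\<forall>z. isCont F z \<longrightarrow> (\<lambda>n. Fs n z) \<longlonglongrightarrow> F z)"

end

theory Submission
  imports Defs "HOL-Real_Asymp.Real_Asymp"
begin

text \<open>Everything that a CSPH distribution has to approximate can be put into the state entered at the common
  shock. Let the shock occur almost at once, after an exponential time of large rate, and let the state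
  \<open>K\<close> entered at the shock be a point \<open>(i, j)\<close> of a finite grid, drawn from a discretisation
  of \<open>\<nu>\<close>. Let \<open>Q1\<close> count the first coordinate of the grid point down to zero and then
  absorb, one unit per exponential time of rate \<open>r\<close>, and let \<open>Q2\<close> do the same with the
  second coordinate. Given \<open>K = (i, j)\<close> the two absorption times are then independent Erlang variables
  with means \<open>(i + 1) / r\<close> and \<open>(j + 1) / r\<close>. Both matrices act on the same states and start
  from the same \<open>K\<close>, and yet they produce two times that can be prescribed separately; the dependence
  between the marginals of \<open>\<nu>\<close> is carried by the law of \<open>K\<close> alone. The scaling factors
  only multiply a common-shock time that tends to zero.

  With \<open>r = (n + 1)^2\<close> and coordinates up to \<open>N = (n + 1)^3\<close> the mesh \<open>1 / r\<close>
  of the grid tends to zero, its extent \<open>N / r = n + 1\<close> tends to infinity, and the Erlang variances, at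
  most \<open>(N + 1) / r^2\<close>, tend to zero. Hence Chebyshev's inequality shows that \<open>(X1, X2)\<close> is
  close in probability to a discretisation of a \<open>\<nu>\<close>-distributed point
  (\<open>csph_near_grid_law\<close>, \<open>csph_approximation\<close>). So the distribution functions are squeezed
  between values of \<open>F\<close> at diagonally shifted points, which gives convergence at every continuity point
  of \<open>F\<close> (\<open>tendsto_diagonal_sandwich\<close>).

  The larger part of the work is to show that the process built in this way is a common-shock process in the sense of
  \<^const>\<open>csph_construction\<close>. The sample space is a countable product of laws on the real line:
  coordinate 0 is the shock time, coordinate 1 encodes \<open>K\<close>, and the even and odd coordinates from 2 on
  are the holding times of \<open>J1\<close> and \<open>J2\<close>. Conditioning on \<open>K = k\<close> only replaces
  the factor at coordinate 1 (\<open>uniform_measure_PiM_coordinate\<close>), so that the coordinates remain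
  independent and the holding times keep their law; and on the event \<open>K = k\<close> the path of
  \<open>J1\<close> is a fixed function of the even coordinates and that of \<open>J2\<close> of the odd ones.\<close>

section \<open>Countdown processes and their absorption times\<close>

text \<open>A state \<open>k\<close> has \<open>h k\<close> steps left before the last phase, and \<open>d\<close>
  performs one step; every phase, the last one included, lasts an exponential time of rate \<open>r\<close>. So
  absorption from \<open>k\<close> takes \<open>h k + 1\<close> phases.\<close>
locale countdown =
  fixes S :: "'s set" and h :: "'s \<Rightarrow> nat" and d :: "'s \<Rightarrow> 's" and r :: real
  assumes finite_S: "finite S" and r_pos: "0 < r"
    and step_in: "\<And>k. k \<in> S \<Longrightarrow> 0 < h k \<Longrightarrow> d k \<in> S"
    and step_rank: "\<And>k. k \<in> S \<Longrightarrow> 0 < h k \<Longrightarrow> h (d k) = h k - 1"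
begin

text \<open>The two summands never overlap on \<open>S\<close>, since \<open>d\<close> lowers the rank; writing them
  as a sum keeps row sums easy to evaluate.\<close>
definition rates :: "'s \<Rightarrow> 's \<Rightarrow> real" where
  "rates k l = (if l = k then - r else 0) + (if 0 < h k \<and> l = d k then r else 0)"

text \<open>From every state there is only one possible jump, so the jump chain started at \<open>k\<close> is not
  random.\<close>
definition chain :: "'s \<Rightarrow> nat \<Rightarrow> 's option" where
  "chain k n = (if n \<le> h k then Some ((d ^^ n) k) else None)"

text \<open>The state at time \<open>t\<close> when \<open>c\<close> lists the holding times: the cardinality is the
  number of completed phases. Cutting the holding times off below at 0 makes the jump epochs nondecreasing for every
  real sequence \<open>c\<close>, so that statements about trajectories need no exceptional null set.\<close>
definition trajectory :: "'s \<Rightarrow> (nat \<Rightarrow> real) \<Rightarrow> real \<Rightarrow> 's option" where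
  "trajectory k c t = chain k (card {n. n \<le> h k \<and> (\<Sum>m\<le>n. max 0 (c m)) \<le> t})"

lemma step_neq: "k \<in> S \<Longrightarrow> 0 < h k \<Longrightarrow> d k \<noteq> k"
  using step_rank[of k] by auto

lemma rates_diag: "k \<in> S \<Longrightarrow> rates k k = - r"
  using step_neq[of k] by (auto simp: rates_def)

lemma sum_rates:
  assumes "k \<in> S"
  shows "(\<Sum>l\<in>S. rates k l * v l) = - r * v k + (if 0 < h k then r * v (d k) else 0)"
proof -
  have "(\<Sum>l\<in>S. rates k l * v l) =
    (\<Sum>l\<in>S. if l = k then - r * v l else 0) + (\<Sum>l\<in>S. if l = d k then (if 0 < h k then r * v l else 0) else 0)"
    unfolding sum.distrib[symmetric] rates_def by (intro sum.cong) (auto simp: algebra_simps)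
  then show ?thesis
    using assms finite_S step_in[of k] by simp
qed

lemma row_sum_rates: "k \<in> S \<Longrightarrow> (\<Sum>l\<in>S. rates k l) = (if 0 < h k then 0 else - r)"
  using sum_rates[of k "\<lambda>_. 1"] by simp

lemma subintensity_rates: "subintensity_matrix S rates"
  using r_pos unfolding subintensity_matrix_def
  by (auto simp: rates_diag row_sum_rates) (auto simp: rates_def)

text \<open>Ordered by rank the matrix is triangular with diagonal \<open>- r\<close>, so a vector in its kernel
  vanishes rank by rank.\<close>
lemma nonsingular_rates: "nonsingular_on S rates"
  unfolding nonsingular_on_def
proof safe
  fix v i
  assume v: "\<forall>i\<in>S. (\<Sum>j\<in>S. rates i j * v j) = 0" and i: "i \<in> S"
  show "v i = 0"
    using i
  proof (induction "h i" arbitrary: i rule: less_induct)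
    case less
    have "0 < h i \<Longrightarrow> v (d i) = 0"
      using less.prems by (intro less.hyps) (auto simp: step_rank step_in)
    then show ?case
      using v less.prems r_pos by (auto simp: sum_rates split: if_splits)
  qed
qed

lemma iterate_step:
  assumes "k \<in> S" "n \<le> h k"
  shows "(d ^^ n) k \<in> S" "h ((d ^^ n) k) = h k - n"
proof -
  have "(d ^^ n) k \<in> S \<and> h ((d ^^ n) k) = h k - n"
    using assms(2)
  proof (induction n)
    case (Suc n)
    then show ?case by (auto simp: step_in step_rank)
  qed (simp add: assms)
  then show "(d ^^ n) k \<in> S" "h ((d ^^ n) k) = h k - n" by auto
qed

lemma chain_in: "k \<in> S \<Longrightarrow> chain k n \<in> absorbing_states S"
  by (auto simp: chain_def absorbing_states_def iterate_step)

text \<open>Each row of the jump matrix is a unit vector at the successor in the chain, with the absorbing state as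
  successor of the last phase.\<close>
lemma jump_chain:
  assumes k: "k \<in> S" and j: "j \<in> absorbing_states S"
  shows "jump_matrix (absorbing_intensity S rates) (chain k n) j = (if j = chain k (Suc n) then 1 else 0)"
proof (cases "n \<le> h k")
  case False
  then show ?thesis by (auto simp: chain_def jump_matrix_def)
next
  case True
  define l where "l = (d ^^ n) k"
  have l: "l \<in> S" "h l = h k - n"
    using iterate_step[OF k True] by (auto simp: l_def)
  have Suc_chain: "chain k (Suc n) = (if 0 < h l then Some (d l) else None)"
    using True l by (auto simp: chain_def l_def)
  show ?thesis
  proof (cases j)
    case None
    then show ?thesis
      using True l r_pos by (simp only: Suc_chain) (simp add: chain_def l_def[symmetric] jump_matrix_def rates_diag row_sum_rates del: diff_is_0_eq)
  next
    case (Some i)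
    then show ?thesis
      using True l r_pos step_neq[of l]
      by (simp only: Suc_chain) (auto simp: chain_def l_def[symmetric] jump_matrix_def rates_diag rates_def)
  qed
qed

lemma chain_law:
  assumes k: "k \<in> S" and i: "\<forall>m\<le>n. i m \<in> absorbing_states S"
  shows "(if i 0 = Some k then 1 else 0) *
     (\<Prod>m<n. jump_matrix (absorbing_intensity S rates) (i m) (i (Suc m))) =
     (if \<forall>m\<le>n. i m = chain k m then 1 else 0 :: real)"
  using i
proof (induction n)
  case 0
  then show ?case by (simp add: chain_def)
next
  case (Suc n)
  have "(if i 0 = Some k then 1 else 0) *
     (\<Prod>m<Suc n. jump_matrix (absorbing_intensity S rates) (i m) (i (Suc m))) =
     (if \<forall>m\<le>n. i m = chain k m then 1 else 0 :: real) *
       jump_matrix (absorbing_intensity S rates) (i n) (i (Suc n))"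
    using Suc by (simp add: mult.assoc[symmetric])
  also have "\<dots> = (if \<forall>m\<le>Suc n. i m = chain k m then 1 else 0)"
    using Suc.prems jump_chain[OF k, of "i (Suc n)" n] by (auto simp: le_Suc_eq)
  finally show ?case .
qed

lemma card_level_set:
  fixes c :: "nat \<Rightarrow> real"
  assumes "\<And>m. m \<le> a \<Longrightarrow> m < n \<longleftrightarrow> (\<Sum>j\<le>m. max 0 (c j)) \<le> t" "n \<le> Suc a"
  shows "card {m. m \<le> a \<and> (\<Sum>j\<le>m. max 0 (c j)) \<le> t} = n"
proof -
  have "{m. m \<le> a \<and> (\<Sum>j\<le>m. max 0 (c j)) \<le> t} = {..<n}"
    using assms(1) order.strict_trans2[OF _ assms(2)] by (auto simp: less_Suc_eq_le)
  then show ?thesis by simp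
qed

lemma trajectory_absorbed_iff:
  assumes "k \<in> S"
  shows "trajectory k c t \<notin> Some ` S \<longleftrightarrow> (\<Sum>m\<le>h k. max 0 (c m)) \<le> t"
proof -
  let ?A = "{n. n \<le> h k \<and> (\<Sum>m\<le>n. max 0 (c m)) \<le> t}"
  show ?thesis
  proof (cases "(\<Sum>m\<le>h k. max 0 (c m)) \<le> t")
    case True
    have "(\<Sum>m\<le>n. max 0 (c m)) \<le> t" if "n \<le> h k" for n
      using that True by (intro order_trans[OF sum_mono2 True]) auto
    then have "?A = {..h k}" by auto
    then show ?thesis
      using True by (simp add: trajectory_def chain_def)
  next
    case False
    then have "?A \<subseteq> {..<h k}" by (auto simp: less_le)
    then have "card ?A \<le> h k"
      by (metis card_lessThan card_mono finite_lessThan)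
    then show ?thesis
      using False assms by (auto simp: trajectory_def chain_def iterate_step)
  qed
qed

text \<open>This is where the Erlang distribution comes from: absorption occurs when all \<open>h k + 1\<close> phases
  are over.\<close>
lemma absorption_time:
  assumes "k \<in> S"
  shows "Inf {t. 0 \<le> t \<and> trajectory k c t \<notin> Some ` S} = (\<Sum>m\<le>h k. max 0 (c m))"
proof -
  have "0 \<le> (\<Sum>m\<le>h k. max 0 (c m))" by (intro sum_nonneg) auto
  then have "{t. 0 \<le> t \<and> trajectory k c t \<notin> Some ` S} = {(\<Sum>m\<le>h k. max 0 (c m))..}"
    using trajectory_absorbed_iff[OF assms] by auto
  then show ?thesis by simp
qed

text \<open>The holding times in the sense of \<^const>\<open>markov_jump_process\<close>: after absorption the rate
  is zero and the holding time infinite.\<close>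
definition holding :: "'s \<Rightarrow> (nat \<Rightarrow> real) \<Rightarrow> nat \<Rightarrow> ennreal" where
  "holding k c m = (if m \<le> h k then ennreal (c m) else \<infinity>)"

lemma sum_holding:
  "n \<le> h k \<Longrightarrow> (\<Sum>m\<le>n. holding k c m) = ennreal (\<Sum>m\<le>n. max 0 (c m))"
  by (subst sum_ennreal[symmetric]) (auto simp: holding_def intro!: sum.cong ennreal_cong split: split_max)

text \<open>An infinite holding time never ends, so \<open>n\<close> is at most \<open>h k + 1\<close> and all sums in
  question are finite.\<close>
lemma trajectory_eq_chain:
  assumes "0 \<le> t" and lower: "(\<Sum>m<n. holding k c m) \<le> ennreal t"
    and upper: "ennreal t < (\<Sum>m\<le>n. holding k c m)"
  shows "trajectory k c t = chain k n"
proof -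
  have n: "n \<le> Suc (h k)"
  proof (rule ccontr)
    assume "\<not> n \<le> Suc (h k)"
    then have "holding k c (Suc (h k)) \<le> (\<Sum>m<n. holding k c m)"
      by (intro member_le_sum) auto
    then have "\<infinity> \<le> ennreal t"
      using lower by (auto simp: holding_def dest: order_trans)
    then show False
      by (simp add: top_unique)
  qed
  have "m < n \<longleftrightarrow> (\<Sum>j\<le>m. max 0 (c j)) \<le> t" if m: "m \<le> h k" for m
  proof
    assume "m < n"
    then have "(\<Sum>j\<le>m. holding k c j) \<le> (\<Sum>j<n. holding k c j)"
      by (intro sum_mono2) auto
    then have "ennreal (\<Sum>j\<le>m. max 0 (c j)) \<le> ennreal t"
      using lower by (simp add: sum_holding[OF m])
    then show "(\<Sum>j\<le>m. max 0 (c j)) \<le> t"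
      using \<open>0 \<le> t\<close> by simp
  next
    assume le: "(\<Sum>j\<le>m. max 0 (c j)) \<le> t"
    show "m < n"
    proof (rule ccontr)
      assume "\<not> m < n"
      then have "(\<Sum>j\<le>n. holding k c j) \<le> (\<Sum>j\<le>m. holding k c j)"
        by (intro sum_mono2) auto
      then have "ennreal t < ennreal (\<Sum>j\<le>m. max 0 (c j))"
        using upper by (simp add: sum_holding[OF m])
      then show False
        using le \<open>0 \<le> t\<close> by (simp add: ennreal_less_iff)
    qed
  qed
  from card_level_set[OF this n] show ?thesis
    by (simp add: trajectory_def)
qed

lemma measurable_trajectory:
  assumes k: "k \<in> S" and [measurable]: "\<And>m. C m \<in> borel_measurable M"
  shows "(\<lambda>\<omega>. trajectory k (\<lambda>m. C m \<omega>) t) \<in> M \<rightarrow>\<^sub>M count_space (absorbing_states S)"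
  unfolding trajectory_def
  by (rule measurable_compose[where N="count_space UNIV"]) (auto intro: chain_in[OF k])

text \<open>As the jump chain is deterministic, the prescribed law of \<open>(Y 0, H 0), \<dots>, (Y n, H n)\<close>
  reduces to independence and the exponential tails of the holding times. The process \<open>X\<close> is assumed to
  follow the trajectory only almost surely, since the processes of interest start from \<open>k\<close> only on a set
  of full conditional measure.\<close>
lemma markov_jump_process_trajectory:
  assumes "prob_space N" and k: "k \<in> S"
    and indep: "prob_space.indep_vars N (\<lambda>_. borel) C UNIV"
    and exp_C: "\<And>n. distributed N lborel (C n) (exponential_density r)"
    and X: "\<And>t. 0 \<le> t \<Longrightarrow> X t \<in> N \<rightarrow>\<^sub>M count_space (absorbing_states S)"
    and X_path: "AE \<omega> in N. \<forall>t\<ge>0. X t \<omega> = trajectory k (\<lambda>m. C m \<omega>) t"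
  shows "markov_jump_process N (absorbing_states S) (\<lambda>x. if x = Some k then 1 else 0)
     (absorbing_intensity S rates) X"
proof -
  interpret N: prob_space N by fact
  have C[measurable]: "C n \<in> borel_measurable N" for n
    using distributed_measurable[OF exp_C] by simp
  let ?L = "absorbing_intensity S rates"
  have law: "measure N {\<omega> \<in> space N. \<forall>m\<le>n. chain k m = i m \<and> ennreal (t m) < holding k (\<lambda>m. C m \<omega>) m} =
     (if i 0 = Some k then 1 else 0) * (\<Prod>m<n. jump_matrix ?L (i m) (i (Suc m)))
       * (\<Prod>m\<le>n. exp (?L (i m) (i m) * t m))"
    if it: "\<forall>m\<le>n. i m \<in> absorbing_states S \<and> 0 \<le> t m" for n and i :: "nat \<Rightarrow> 's option" and t :: "nat \<Rightarrow> real"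
  proof (cases "\<forall>m\<le>n. i m = chain k m")
    case False
    then have empty: "{\<omega> \<in> space N. \<forall>m\<le>n. chain k m = i m \<and> ennreal (t m) < holding k (\<lambda>m. C m \<omega>) m} = {}"
      by force
    have zero: "(if i 0 = Some k then 1 else 0) * (\<Prod>m<n. jump_matrix ?L (i m) (i (Suc m))) = 0"
      by (subst chain_law[OF k]) (use it False in auto)
    show ?thesis
      unfolding empty zero by simp
  next
    case True
    define A where "A m = (if m \<le> h k then {t m<..} else UNIV)" for m
    have "{\<omega> \<in> space N. \<forall>m\<le>n. chain k m = i m \<and> ennreal (t m) < holding k (\<lambda>m. C m \<omega>) m}
        = (\<Inter>m\<in>{..n}. C m -` A m \<inter> space N)"
      using True it by (auto simp: holding_def A_def ennreal_less_iff split: if_splits)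
    also have "N.prob \<dots> = (\<Prod>m\<le>n. N.prob (C m -` A m \<inter> space N))"
      by (rule N.indep_varsD[OF indep]) (auto simp: A_def)
    also have "\<dots> = (\<Prod>m\<le>n. exp (?L (i m) (i m) * t m))"
    proof (intro prod.cong refl)
      fix m assume "m \<in> {..n}"
      then have m: "m \<le> n" by simp
      show "N.prob (C m -` A m \<inter> space N) = exp (?L (i m) (i m) * t m)"
      proof (cases "m \<le> h k")
        case le: True
        have "C m -` A m \<inter> space N = {\<omega>\<in>space N. t m < C m \<omega>}"
          using le by (auto simp: A_def)
        then show ?thesis
          using N.exponential_distributedD_gt[OF exp_C, of "t m" m] r_pos it m True le
          by (simp add: chain_def rates_diag iterate_step[OF k] mult.commute)
      next
        case False
        then show ?thesis
          using True m by (simp add: A_def chain_def N.prob_space)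
      qed
    qed
    finally show ?thesis
      using it True by (subst chain_law[OF k]) simp_all
  qed
  have paths: "AE \<omega> in N. \<forall>t\<ge>0. \<forall>n. (\<Sum>m<n. holding k (\<lambda>m. C m \<omega>) m) \<le> ennreal t \<and>
      ennreal t < (\<Sum>m\<le>n. holding k (\<lambda>m. C m \<omega>) m) \<longrightarrow> X t \<omega> = chain k n"
    using X_path by eventually_elim (auto simp: trajectory_eq_chain)
  have [measurable]: "(\<lambda>\<omega>. holding k (\<lambda>m. C m \<omega>) n) \<in> borel_measurable N" for n
    unfolding holding_def by measurable
  show ?thesis
    unfolding markov_jump_process_def
  proof (intro conjI exI[of _ "\<lambda>n \<omega>. chain k n"] exI[of _ "\<lambda>n \<omega>. holding k (\<lambda>m. C m \<omega>) n"])
    show "finite (absorbing_states S)" by (simp add: absorbing_states_def finite_S)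
    show "\<forall>n i t. (\<forall>m\<le>n. i m \<in> absorbing_states S \<and> 0 \<le> t m) \<longrightarrow>
       measure N {\<omega> \<in> space N. \<forall>m\<le>n. chain k m = i m \<and> ennreal (t m) < holding k (\<lambda>m. C m \<omega>) m} =
       (if i 0 = Some k then 1 else 0) * (\<Prod>m<n. jump_matrix ?L (i m) (i (Suc m)))
       * (\<Prod>m\<le>n. exp (?L (i m) (i m) * t m))"
      using law by blast
  qed (fact paths | simp add: X N.prob_space_axioms chain_in[OF k])+
qed

end

section \<open>Conditioning and independence in product spaces\<close>

text \<open>Conditioning a product measure on an event in one coordinate conditions that factor and leaves the others
  unchanged. It suffices to compare both sides on finite-dimensional boxes, where each is a product of factor
  masses.\<close>
lemma uniform_measure_PiM_coordinate:
  assumes M: "\<And>i. prob_space (M i)" and j: "j \<in> I"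
    and B: "B \<in> sets (M j)" "emeasure (M j) B \<noteq> 0"
  shows "uniform_measure (PiM I M) {\<omega> \<in> space (PiM I M). \<omega> j \<in> B} =
    PiM I (M(j := uniform_measure (M j) B))"
proof -
  interpret M: prob_space "M i" for i by (rule M)
  interpret P: product_prob_space M I ..
  define M' where "M' = M(j := uniform_measure (M j) B)"
  have "prob_space (M' i)" for i
    using B by (auto simp: M'_def M intro!: prob_space_uniform_measure)
  then interpret M': prob_space "M' i" for i .
  interpret P': product_prob_space M' I ..
  have sets_M': "sets (M' i) = sets (M i)" for i
    by (simp add: M'_def)
  have space_M': "space (M' i) = space (M i)" for i
    by (simp add: M'_def)
  have cond: "{\<omega> \<in> space (PiM I M). \<omega> j \<in> B} \<in> sets (PiM I M)"
    using B j by (intro sets_Collect_single') auto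
  have mass: "emeasure (PiM I M) {\<omega> \<in> space (PiM I M). \<omega> j \<in> B} = emeasure (M j) B"
    using B j by (intro P.emeasure_PiM_Collect_single)
  have "uniform_measure (PiM I M) {\<omega> \<in> space (PiM I M). \<omega> j \<in> B} = PiM I M'"
  proof (rule P'.PiM_eq)
    show "sets (uniform_measure (PiM I M) {\<omega> \<in> space (PiM I M). \<omega> j \<in> B}) = sets (PiM I M')"
      by (auto intro!: sets_PiM_cong simp: sets_M')
  next
    fix J F assume J: "finite J" "J \<subseteq> I" and F': "\<And>i. i \<in> J \<Longrightarrow> F i \<in> sets (M' i)"
    then have F: "\<And>i. i \<in> J \<Longrightarrow> F i \<in> sets (M i)"
      by (simp add: sets_M')
    \<comment> \<open>The condition added as one more constraint, in case \<open>j\<close> is not yet among the constrained coordinates.\<close>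
    define G where "G i = (if i \<in> J then F i else space (M i)) \<inter> (if i = j then B else space (M i))" for i
    have G: "G i \<in> sets (M i)" for i
      using F B by (auto simp: G_def)
    have G_other: "G i = F i" if "i \<in> J - {j}" for i
      using that sets.sets_into_space[OF F, of i] by (auto simp: G_def)
    have emb_eq: "prod_emb I M' J (Pi\<^sub>E J F) = prod_emb I M J (Pi\<^sub>E J F)"
      by (simp add: prod_emb_def space_M')
    have emb: "prod_emb I M J (Pi\<^sub>E J F) \<in> sets (PiM I M)"
      using J F by (intro sets_PiM_I) auto
    have "{\<omega> \<in> space (PiM I M). \<omega> j \<in> B} \<inter> prod_emb I M J (Pi\<^sub>E J F) =
        {\<omega> \<in> space (PiM I M). \<forall>i\<in>insert j J. \<omega> i \<in> G i}"
      using J j sets.sets_into_space[OF B(1)]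
      by (auto simp: prod_emb_def space_PiM G_def PiE_iff extensional_def split: if_splits)
    then have "emeasure (uniform_measure (PiM I M) {\<omega> \<in> space (PiM I M). \<omega> j \<in> B}) (prod_emb I M J (Pi\<^sub>E J F))
        = emeasure (PiM I M) {\<omega> \<in> space (PiM I M). \<forall>i\<in>insert j J. \<omega> i \<in> G i} / emeasure (M j) B"
      by (simp add: emeasure_uniform_measure[OF cond emb] mass)
    also have "\<dots> = (\<Prod>i\<in>insert j J. emeasure (M i) (G i)) / emeasure (M j) B"
      using J j G by (subst P.emeasure_PiM_Collect) auto
    also have "(\<Prod>i\<in>insert j J. emeasure (M i) (G i)) = emeasure (M j) (G j) * (\<Prod>i\<in>J - {j}. emeasure (M i) (F i))"
      using J by (subst prod.insert_remove) (auto intro!: prod.cong simp: G_other)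
    also have "\<dots> / emeasure (M j) B = (emeasure (M j) (G j) / emeasure (M j) B) * (\<Prod>i\<in>J - {j}. emeasure (M i) (F i))"
      by (simp add: divide_ennreal_def ac_simps)
    also have "\<dots> = (\<Prod>i\<in>J. emeasure (M' i) (F i))"
    proof (cases "j \<in> J")
      case True
      have "G j = B \<inter> F j" using True by (auto simp: G_def)
      then have "emeasure (M j) (G j) / emeasure (M j) B = emeasure (M' j) (F j)"
        using True B F by (simp add: M'_def)
      moreover have "(\<Prod>i\<in>J - {j}. emeasure (M i) (F i)) = (\<Prod>i\<in>J - {j}. emeasure (M' i) (F i))"
        by (intro prod.cong) (auto simp: M'_def)
      ultimately show ?thesis
        using prod.remove[OF J(1) True, of "\<lambda>i. emeasure (M' i) (F i)"] by simp
    next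
      case False
      have "G j = B" using False sets.sets_into_space[OF B(1)] by (auto simp: G_def)
      moreover have "(\<Prod>i\<in>J - {j}. emeasure (M i) (F i)) = (\<Prod>i\<in>J. emeasure (M' i) (F i))"
        using False by (intro prod.cong) (auto simp: M'_def)
      ultimately show ?thesis
        using B by (simp add: less_top[symmetric] M.emeasure_finite)
    qed
    finally show "emeasure (uniform_measure (PiM I M) {\<omega> \<in> space (PiM I M). \<omega> j \<in> B}) (prod_emb I M' J (Pi\<^sub>E J F))
        = (\<Prod>i\<in>J. emeasure (M' i) (F i))"
      by (simp add: emb_eq)
  qed
  then show ?thesis by (simp add: M'_def)
qed

text \<open>A family is independent iff its joint law is the product of the marginals; for the coordinates the joint
  law is the product measure itself.\<close>
lemma indep_vars_PiM_coordinates: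
  assumes M: "\<And>i. prob_space (M i)" and sets_M: "\<And>i. sets (M i) = sets borel" and "I \<noteq> {}"
  shows "prob_space.indep_vars (PiM I M) (\<lambda>_. borel) (\<lambda>i \<omega>. \<omega> i) I"
proof -
  interpret M: prob_space "M i" for i by (rule M)
  interpret P: product_prob_space M I ..
  have [measurable]: "(\<lambda>\<omega>. \<omega> i) \<in> PiM I M \<rightarrow>\<^sub>M borel" if "i \<in> I" for i
    using measurable_component_singleton[OF that, of M] measurable_cong_sets[OF refl sets_M] by metis
  have "distr (PiM I M) (\<Pi>\<^sub>M i\<in>I. borel) (\<lambda>x. \<lambda>i\<in>I. x i) = distr (PiM I M) (PiM I M) (\<lambda>x. x)"
    by (rule distr_cong) (auto simp: sets_M space_PiM PiE_restrict intro!: sets_PiM_cong)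
  also have "\<dots> = (\<Pi>\<^sub>M i\<in>I. distr (PiM I M) borel (\<lambda>x. x i))"
  proof (subst distr_id, rule PiM_cong)
    fix i assume i: "i \<in> I"
    have "distr (PiM I M) borel (\<lambda>x. x i) = distr (PiM I M) (M i) (\<lambda>x. x i)"
      by (rule distr_cong) (auto simp: sets_M)
    then show "M i = distr (PiM I M) borel (\<lambda>x. x i)"
      using P.PiM_component[OF i] by simp
  qed simp
  finally show ?thesis
    using \<open>I \<noteq> {}\<close> by (subst P.indep_vars_iff_distr_eq_PiM') auto
qed

text \<open>Together with \<open>indep_sets_AE_representatives\<close> below, this transfers independence from the
  coordinates to event systems that agree with coordinate events only up to null sets. Such systems arise because,
  under the conditional law given \<open>K = k\<close>, the processes after the shock still start from a random state
  that is merely almost surely \<open>k\<close>.\<close>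
lemma sigma_sets_AE_representative:
  assumes "sigma_algebra (space M) G"
    and gen: "\<And>A. A \<in> E \<Longrightarrow> \<exists>B\<in>G. AE x in M. x \<in> A \<longleftrightarrow> x \<in> B"
    and A: "A \<in> sigma_sets (space M) E"
  shows "\<exists>B\<in>G. AE x in M. x \<in> A \<longleftrightarrow> x \<in> B"
  using A
proof induction
  interpret sigma_algebra "space M" G by fact
  { case Empty then show ?case by (intro bexI[of _ "{}"]) auto }
  { case (Compl A)
    then obtain B where "B \<in> G" "AE x in M. x \<in> A \<longleftrightarrow> x \<in> B" by auto
    then show ?case by (intro bexI[of _ "space M - B"]) auto }
  { case (Union A)
    then obtain B where B: "\<And>i. B i \<in> G" "\<And>i. AE x in M. x \<in> A i \<longleftrightarrow> x \<in> B i" by metis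
    then have "AE x in M. \<forall>i. x \<in> A i \<longleftrightarrow> x \<in> B i" by (simp add: AE_all_countable)
    with B(1) show ?case by (intro bexI[of _ "\<Union>i. B i"]) auto }
qed (use gen in auto)

lemma (in prob_space) indep_sets_AE_representatives:
  assumes G: "indep_sets G I"
    and F: "\<And>i. i \<in> I \<Longrightarrow> F i \<subseteq> events"
    and rep: "\<And>i A. i \<in> I \<Longrightarrow> A \<in> F i \<Longrightarrow> \<exists>B\<in>G i. AE x in M. x \<in> A \<longleftrightarrow> x \<in> B"
  shows "indep_sets F I"
proof (rule indep_setsI)
  fix A J assume J: "J \<noteq> {}" "J \<subseteq> I" "finite J" and A: "\<forall>j\<in>J. A j \<in> F j"
  have "\<forall>j\<in>J. \<exists>B. B \<in> G j \<and> (AE x in M. x \<in> A j \<longleftrightarrow> x \<in> B)"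
    using rep A J by blast
  then obtain B where B: "\<And>j. j \<in> J \<Longrightarrow> B j \<in> G j" "\<And>j. j \<in> J \<Longrightarrow> AE x in M. x \<in> A j \<longleftrightarrow> x \<in> B j"
    by metis
  have A_ev: "A j \<in> events" if "j \<in> J" for j
    using A F that J by blast
  have B_ev: "B j \<in> events" if "j \<in> J" for j
    using B G that J unfolding indep_sets_def by blast
  have "AE x in M. \<forall>j\<in>J. x \<in> A j \<longleftrightarrow> x \<in> B j"
    using B J by (simp add: AE_ball_countable countable_finite)
  then have "prob (\<Inter>j\<in>J. A j) = prob (\<Inter>j\<in>J. B j)"
    using J A_ev B_ev by (intro finite_measure_eq_AE sets.finite_INT) auto
  also have "\<dots> = (\<Prod>j\<in>J. prob (B j))"
    using B J by (intro indep_setsD[OF G]) auto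
  also have "\<dots> = (\<Prod>j\<in>J. prob (A j))"
    using B A_ev B_ev by (intro prod.cong refl finite_measure_eq_AE[symmetric]) auto
  finally show "prob (\<Inter>j\<in>J. A j) = (\<Prod>j\<in>J. prob (A j))" .
qed (use F in auto)

text \<open>Chebyshev's inequality for the Erlang variable; the truncations at 0 are almost surely vacuous.\<close>
lemma (in prob_space) exponential_sum_deviation:
  assumes l: "0 < l" and d: "0 < \<delta>"
    and indep: "indep_vars (\<lambda>_. borel) C UNIV"
    and exp_C: "\<And>n::nat. distributed M lborel (C n) (exponential_density l)"
  shows "prob {\<omega> \<in> space M. \<delta> \<le> \<bar>(\<Sum>m\<le>n. max 0 (C m \<omega>)) - real (n + 1) / l\<bar>} \<le> real (n + 1) / (l * \<delta>)\<^sup>2"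
proof -
  have C[measurable]: "random_variable borel (C m)" for m
    using distributed_measurable[OF exp_C] by simp
  let ?T = "\<lambda>\<omega>. \<Sum>m\<le>n. C m \<omega>"
  have T: "distributed M lborel ?T (erlang_density n l)"
    using exponential_distributed_sum[OF _ _ l exp_C, of "{..n}"] indep_vars_subset[OF indep, of "{..n}"] by simp
  have mean: "expectation ?T = real (n + 1) / l"
    using erlang_ith_moment[OF l T, of 1] by (simp add: fact_reduce)
  have "AE \<omega> in M. 0 \<le> C m \<omega>" for m
  proof -
    have "prob {\<omega> \<in> space M. 0 < C m \<omega>} = 1"
      using exponential_distributedD_gt[OF exp_C _ l, of 0 m] by simp
    then have "AE \<omega> in M. 0 < C m \<omega>" by (subst (asm) prob_Collect_eq_1) auto
    then show ?thesis by eventually_elim simp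
  qed
  then have "AE \<omega> in M. \<forall>m. 0 \<le> C m \<omega>" by (simp add: AE_all_countable)
  then have "prob {\<omega> \<in> space M. \<delta> \<le> \<bar>(\<Sum>m\<le>n. max 0 (C m \<omega>)) - real (n + 1) / l\<bar>}
      = prob {\<omega> \<in> space M. \<delta> \<le> \<bar>?T \<omega> - expectation ?T\<bar>}"
    unfolding mean by (intro finite_measure_eq_AE) (auto elim!: eventually_mono simp: max_def)
  also have "\<dots> \<le> variance ?T / \<delta>\<^sup>2"
    using erlang_ith_moment_integrable[OF l T, of 2] d by (intro Chebyshev_inequality) auto
  also have "\<dots> = real (n + 1) / (l * \<delta>)\<^sup>2"
    by (subst erlang_distributed_variance[OF l T]) (simp add: power_mult_distrib)
  finally show ?thesis .
qed

section \<open>The process up to the common shock\<close>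

lemma exponential_coordinate:
  assumes "\<And>i. prob_space (M i)" and "M i = density lborel (exponential_density r)"
  shows "distributed (PiM UNIV M) lborel (\<lambda>\<omega>. \<omega> i) (exponential_density r)"
proof -
  have s: "sets (M i) = sets lborel" by (simp add: assms(2))
  have "distr (PiM UNIV M) lborel (\<lambda>\<omega>. \<omega> i) = distr (PiM UNIV M) (M i) (\<lambda>\<omega>. \<omega> i)"
    by (rule distr_cong) (auto simp: s)
  also have "\<dots> = M i"
    by (rule distr_PiM_component) (auto simp: assms(1))
  finally have "distr (PiM UNIV M) lborel (\<lambda>\<omega>. \<omega> i) = density lborel (exponential_density r)"
    by (simp add: assms(2))
  moreover have "(\<lambda>\<omega>. \<omega> i) \<in> PiM UNIV M \<rightarrow>\<^sub>M lborel"
    using measurable_component_singleton[of i UNIV M] measurable_cong_sets[OF refl s] by blast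
  ultimately show ?thesis
    by (simp add: distributed_def)
qed

text \<open>The process takes values in \<open>I\<close>, so a preimage of any set is the preimage of its part in
  \<open>I\<close>, which is measurable for the counting space of \<open>I\<close>.\<close>
lemma process_events_subset:
  assumes "\<And>t. 0 \<le> t \<Longrightarrow> X t \<in> M \<rightarrow>\<^sub>M count_space I"
  shows "process_events M X \<subseteq> sets M"
  unfolding process_events_def
proof (rule sets.sigma_sets_subset, safe)
  fix t :: real and A assume "0 \<le> t"
  then have "X t -` A \<inter> space M = X t -` (A \<inter> I) \<inter> space M"
    using measurable_space[OF assms] by auto
  also have "\<dots> \<in> sets M"
    using assms[OF \<open>0 \<le> t\<close>] by (rule measurable_sets) simp
  finally show "X t -` A \<inter> space M \<in> sets M" .
qed

text \<open>Before the shock there is the single state \<open>e\<close> with exit rate \<open>l\<close>;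
  \<open>D\<close> is the law of the state entered at the shock and \<open>r\<close> the rate of every phase after
  it.\<close>
locale common_shock =
  fixes S :: "nat set" and e :: nat and l r :: real and D :: "nat measure"
  assumes finite_S: "finite S" and e_notin: "e \<notin> S" and l_pos: "0 < l" and r_pos: "0 < r"
    and prob_D: "prob_space D" and sets_D: "sets D = UNIV" and D_S: "AE k in D. k \<in> S"
begin

lemma space_D: "space D = UNIV"
  using sets_D sets.sets_into_space by blast

lemma S_nonempty: "S \<noteq> {}"
proof
  assume "S = {}"
  then have "AE k in D. False" using D_S by simp
  then show False using prob_space.AE_False[OF prob_D] by simp
qed

lemma mass_outside: "k \<notin> S \<Longrightarrow> measure D {k} = 0"
  using D_S by (intro measure_eq_0_null_sets) (auto simp: AE_iff_null_sets sets_D elim!: eventually_mono)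

lemma sum_mass: "(\<Sum>k\<in>S. measure D {k}) = 1"
proof -
  interpret D: prob_space D by (rule prob_D)
  have "(\<Sum>k\<in>S. measure D {k}) = measure D S"
    using finite_S by (intro D.finite_measure_eq_sum_singleton[symmetric]) (auto simp: sets_D)
  also have "\<dots> = 1"
    using D_S by (intro D.prob_eq_1[THEN iffD2]) (auto simp: sets_D)
  finally show ?thesis .
qed

definition coordinate_law :: "nat \<Rightarrow> real measure" where
  "coordinate_law i =
     (if i = 0 then density lborel (exponential_density l)
      else if i = 1 then distr D borel real
      else density lborel (exponential_density r))"

definition sample :: "(nat \<Rightarrow> real) measure" where
  "sample = PiM UNIV coordinate_law"

text \<open>A left inverse of the embedding of \<open>S\<close> into the reals, extended to all reals so that it takes
  values in \<open>S\<close> everywhere; coordinate 1 almost surely has its integer part in \<open>S\<close>, so the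
  value chosen elsewhere is arbitrary.\<close>
definition decode_state :: "real \<Rightarrow> nat" where
  "decode_state x = (if nat \<lfloor>x\<rfloor> \<in> S then nat \<lfloor>x\<rfloor> else (SOME k. k \<in> S))"

definition shock_state :: "(nat \<Rightarrow> real) \<Rightarrow> nat" where
  "shock_state \<omega> = decode_state (\<omega> 1)"

definition pre_shock :: "real \<Rightarrow> (nat \<Rightarrow> real) \<Rightarrow> nat" where
  "pre_shock t \<omega> = (if t < \<omega> 0 then e else shock_state \<omega>)"

text \<open>The offset \<open>b\<close> selects the block of coordinates: 2 for the even ones and 3 for the odd ones,
  which leaves out the coordinates 0 and 1.\<close>
definition post_shock :: "(nat \<Rightarrow> nat) \<Rightarrow> (nat \<Rightarrow> nat) \<Rightarrow> nat \<Rightarrow> real \<Rightarrow> (nat \<Rightarrow> real) \<Rightarrow> nat option" where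
  "post_shock h d b t \<omega> = countdown.trajectory h d (shock_state \<omega>) (\<lambda>m. \<omega> (2 * m + b)) t"

lemma prob_coordinate_law: "prob_space (coordinate_law i)"
  using prob_space_exponential_density l_pos r_pos prob_space.prob_space_distr[OF prob_D, of real borel]
  by (auto simp: coordinate_law_def measurable_def sets_D space_D)

lemma sets_coordinate_law: "sets (coordinate_law i) = sets borel"
  by (simp add: coordinate_law_def)

lemma space_coordinate_law: "space (coordinate_law i) = UNIV"
  using sets_eq_imp_space_eq[OF sets_coordinate_law] by simp

lemma space_sample: "space sample = UNIV"
  by (simp add: sample_def space_PiM space_coordinate_law)

sublocale sample: prob_space sample
  unfolding sample_def by (rule prob_space_PiM) (rule prob_coordinate_law)

lemma measurable_coordinate[measurable]: "(\<lambda>\<omega>. \<omega> i) \<in> borel_measurable sample"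
  using measurable_component_singleton[of i UNIV coordinate_law]
    measurable_cong_sets[OF refl sets_coordinate_law] unfolding sample_def by blast

lemma decode_state_in: "decode_state x \<in> S"
  using S_nonempty by (auto simp: decode_state_def intro: someI)

lemma shock_state_in: "shock_state \<omega> \<in> S"
  by (simp add: shock_state_def decode_state_in)

lemma measurable_decode_state[measurable]: "decode_state \<in> borel \<rightarrow>\<^sub>M count_space UNIV"
  unfolding decode_state_def by measurable

lemma decode_state_vimage: "decode_state -` B \<in> sets borel"
  using measurable_sets[OF measurable_decode_state, of B] by simp

lemma measurable_shock_state[measurable]: "shock_state \<in> sample \<rightarrow>\<^sub>M count_space UNIV"
  unfolding shock_state_def by measurable

lemma measurable_shock_state_S: "shock_state \<in> sample \<rightarrow>\<^sub>M count_space S"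
  by (rule measurable_count_space_extend[OF subset_UNIV _ measurable_shock_state])
     (auto simp: shock_state_in)

lemma measure_shock_state: "measure sample {\<omega>. shock_state \<omega> \<in> B} = measure D B"
proof -
  interpret D: prob_space D by (rule prob_D)
  have D_meas: "f \<in> D \<rightarrow>\<^sub>M N" if "\<And>k. f k \<in> space N" for f and N :: "'z measure"
    using that by (auto simp: measurable_def sets_D space_D)
  have "distr sample borel (\<lambda>\<omega>. \<omega> 1) = distr sample (coordinate_law 1) (\<lambda>\<omega>. \<omega> 1)"
    by (rule distr_cong) (auto simp: sets_coordinate_law)
  also have "\<dots> = distr D borel real"
    unfolding sample_def by (subst distr_PiM_component) (auto simp: prob_coordinate_law, simp add: coordinate_law_def)
  finally have law: "distr sample borel (\<lambda>\<omega>. \<omega> 1) = distr D borel real" .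
  have "measure sample {\<omega>. shock_state \<omega> \<in> B} = measure (distr sample borel (\<lambda>\<omega>. \<omega> 1)) (decode_state -` B)"
    by (subst measure_distr) (auto simp: space_sample shock_state_def decode_state_vimage intro!: arg_cong[where f="measure sample"])
  also have "\<dots> = measure D {k. decode_state (real k) \<in> B}"
    unfolding law by (subst measure_distr)
      (auto simp: space_D D_meas decode_state_vimage intro!: arg_cong[where f="measure D"])
  also have "\<dots> = measure D B"
    using D_S by (intro D.finite_measure_eq_AE) (auto simp: sets_D decode_state_def elim!: eventually_mono)
  finally show ?thesis .
qed

text \<open>The states in \<open>S\<close> differ from \<open>e\<close>, so the first exit is at the holding time of
  \<open>e\<close>.\<close>
lemma exit_time_pre_shock: "exit_time pre_shock {e} = (\<lambda>\<omega>. max 0 (\<omega> 0))"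
proof
  fix \<omega> :: "nat \<Rightarrow> real"
  have "shock_state \<omega> \<noteq> e"
    using shock_state_in e_notin by metis
  then have "{t. 0 \<le> t \<and> pre_shock t \<omega> \<notin> {e}} = {max 0 (\<omega> 0)..}"
    by (auto simp: pre_shock_def)
  then show "exit_time pre_shock {e} \<omega> = max 0 (\<omega> 0)"
    by (simp add: exit_time_def)
qed

lemma pre_shock_at_exit: "pre_shock (max 0 (\<omega> 0)) \<omega> = shock_state \<omega>"
  by (simp add: pre_shock_def)

lemma exponential_tail_coordinate:
  assumes "coordinate_law i = density lborel (exponential_density a)" "0 < a" "0 \<le> t"
  shows "measure sample {\<omega>. t < \<omega> i} = exp (- t * a)"
  using sample.exponential_distributedD_gt[OF exponential_coordinate[where M=coordinate_law, OF prob_coordinate_law assms(1), folded sample_def]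
      assms(3,2)] by (simp add: space_sample)

lemma indep_shock:
  assumes "A \<in> sets borel"
  shows "measure sample {\<omega>. \<omega> 0 \<in> A \<and> shock_state \<omega> = k} = measure sample {\<omega>. \<omega> 0 \<in> A} * measure D {k}"
proof -
  have ind: "sample.indep_vars (\<lambda>_. borel) (\<lambda>i \<omega>. \<omega> i) UNIV"
    unfolding sample_def by (rule indep_vars_PiM_coordinates) (auto simp: prob_coordinate_law sets_coordinate_law)
  let ?A = "\<lambda>i. if i = 0 then A else decode_state -` {k}"
  have "measure sample (\<Inter>i\<in>{0, 1::nat}. (\<lambda>\<omega>. \<omega> i) -` ?A i \<inter> space sample) =
    (\<Prod>i\<in>{0, 1::nat}. measure sample ((\<lambda>\<omega>. \<omega> i) -` ?A i \<inter> space sample))"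
    using assms by (intro sample.indep_varsD[OF ind]) (auto simp: decode_state_vimage)
  then show ?thesis
    using measure_shock_state[of "{k}"] by (simp add: space_sample vimage_def shock_state_def Collect_conj_eq)
qed

text \<open>The jump chain is \<open>e\<close> followed by the shock state forever. Its law at given values
  \<open>i 0, \<dots>, i n\<close> is nonzero only if \<open>i 0 = e\<close> and \<open>i 1 = \<dots> = i n\<close>,
  and then it is the mass of \<open>i 1\<close> under \<open>D\<close>; the states of \<open>S\<close> have rate zero
  and contribute factors 1 to the holding time probabilities.\<close>
lemma markov_jump_process_pre_shock:
  "markov_jump_process sample ({e} \<union> S) (\<lambda>i. if i \<in> {e} then 1 else 0)
     (shock_intensity {e} S (\<lambda>_ _. - l) (\<lambda>_ k. l * measure D {k})) pre_shock"
proof -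
  define L where "L = shock_intensity {e} S (\<lambda>_ _. - l) (\<lambda>_ k. l * measure D {k})"
  let ?jump = "\<lambda>(i :: nat \<Rightarrow> nat) n. (if i 0 \<in> {e} then 1 else 0) * (\<Prod>m<n. jump_matrix L (i m) (i (Suc m)))"
  let ?Y = "\<lambda>(n::nat) \<omega>. if n = 0 then e else shock_state \<omega>"
  let ?H = "\<lambda>(n::nat) (\<omega>::nat \<Rightarrow> real). if n = 0 then ennreal (\<omega> 0) else \<infinity>"
  \<comment> \<open>After the first step the chain no longer moves.\<close>
  define frozen where "frozen i n \<longleftrightarrow> i ` {1..n} \<subseteq> {i 1}" for i :: "nat \<Rightarrow> nat" and n :: nat
  have frozen_Suc: "frozen i (Suc n) \<longleftrightarrow> frozen i n \<and> i (Suc n) = i 1" for i n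
    by (simp add: frozen_def atLeastAtMostSuc_conv conj_commute)
  have frozen_0: "frozen i 0" for i
    by (simp add: frozen_def)
  have frozenD: "i m = i 1" if "frozen i n" "0 < m" "m \<le> n" for i m n
  proof -
    have "i m \<in> i ` {1..n}" using that by simp
    then show ?thesis using that(1) unfolding frozen_def by blast
  qed
  have L_e: "L e e = - l" and L_S: "\<And>k j. k \<in> S \<Longrightarrow> L k j = 0"
    using e_notin by (auto simp: L_def shock_intensity_def)
  have jump_e: "jump_matrix L e j = measure D {j}" if "j \<in> {e} \<union> S" for j
    using that e_notin l_pos mass_outside[of e] by (auto simp: jump_matrix_def L_def shock_intensity_def)
  have jump_S: "jump_matrix L k j = (if j = k then 1 else 0)" if "k \<in> S" for j k
    by (simp add: jump_matrix_def L_S[OF that])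
  have jumps: "?jump i n = (if i 0 = e \<and> frozen i n
      then (if n = 0 then 1 else measure D {i 1}) else 0)"
    if "\<forall>m\<le>n. i m \<in> {e} \<union> S" for i n
    using that
  proof (induction n)
    case (Suc n)
    have "?jump i (Suc n) = ?jump i n * jump_matrix L (i n) (i (Suc n))"
      by (simp add: mult.assoc)
    also have "\<dots> = (if i 0 = e \<and> frozen i n
      then (if n = 0 then 1 else measure D {i 1}) else 0) * jump_matrix L (i n) (i (Suc n))"
      by (subst Suc.IH) (use Suc.prems in auto)
    also have "\<dots> = (if i 0 = e \<and> frozen i (Suc n)
      then (if Suc n = 0 then 1 else measure D {i 1}) else 0)"
    proof (cases "n = 0")
      case True
      have i1: "i 1 \<in> {e} \<union> S"
        using Suc.prems True by auto
      then show ?thesis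
        using jump_e[OF i1] True by (simp add: frozen_Suc frozen_0)
    next
      case False
      consider "i 0 = e" "frozen i n" "i 1 \<in> S"
        | "i 0 = e" "frozen i n" "measure D {i 1} = 0"
        | "\<not> (i 0 = e \<and> frozen i n)"
        using mass_outside by blast
      then show ?thesis
      proof cases
        case 1
        then have "i n = i 1" using False by (intro frozenD[of i n]) auto
        then show ?thesis
          using 1 False jump_S[OF 1(3), of "i (Suc n)"] by (simp add: frozen_Suc)
      next
        case 2 then show ?thesis using False by (simp add: frozen_Suc)
      next
        case 3
        then show ?thesis by (auto simp: frozen_Suc)
      qed
    qed
    finally show ?case .
  qed (simp add: frozen_0)
  have law: "measure sample {\<omega> \<in> space sample. \<forall>m\<le>n. ?Y m \<omega> = i m \<and> ennreal (t m) < ?H m \<omega>} =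
      ?jump i n * (\<Prod>m\<le>n. exp (L (i m) (i m) * t m))"
    if it: "\<forall>m\<le>n. i m \<in> {e} \<union> S \<and> 0 \<le> t m" for n and i :: "nat \<Rightarrow> nat" and t :: "nat \<Rightarrow> real"
  proof (cases "i 0 = e \<and> frozen i n")
    case False
    have "\<exists>m\<le>n. ?Y m \<omega> \<noteq> i m" for \<omega>
    proof (rule ccontr)
      assume "\<not> (\<exists>m\<le>n. ?Y m \<omega> \<noteq> i m)"
      then have Y: "?Y m \<omega> = i m" if "m \<le> n" for m using that by blast
      have "i 0 = e" using Y[of 0] by simp
      moreover have "frozen i n"
        unfolding frozen_def
      proof safe
        fix m assume "m \<in> {1..n}"
        then show "i m = i 1" using Y[of m] Y[of 1] by simp
      qed
      ultimately show False using False by blast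
    qed
    then have empty: "{\<omega> \<in> space sample. \<forall>m\<le>n. ?Y m \<omega> = i m \<and> ennreal (t m) < ?H m \<omega>} = {}"
      by blast
    have "?jump i n = 0"
      using it False by (subst jumps) auto
    then show ?thesis
      unfolding empty by (simp only: measure_empty mult_zero_left)
  next
    case True
    have tail: "measure sample {\<omega>. t 0 < \<omega> 0} = exp (L (i 0) (i 0) * t 0)"
      using it True exponential_tail_coordinate[of 0 l "t 0"] l_pos L_e
      by (simp add: coordinate_law_def mult.commute)
    show ?thesis
    proof (cases "n = 0")
      case n0: True
      have "{\<omega> \<in> space sample. \<forall>m\<le>n. ?Y m \<omega> = i m \<and> ennreal (t m) < ?H m \<omega>} = {\<omega>. t 0 < \<omega> 0}"
        using True n0 it by (auto simp: space_sample ennreal_less_iff)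
      then show ?thesis
        using True n0 tail by simp
    next
      case False
      have "{\<omega> \<in> space sample. \<forall>m\<le>n. ?Y m \<omega> = i m \<and> ennreal (t m) < ?H m \<omega>} =
          {\<omega>. \<omega> 0 \<in> {t 0<..} \<and> shock_state \<omega> = i 1}"
      proof (intro Collect_cong iffI)
        fix \<omega> assume "\<omega> \<in> space sample \<and> (\<forall>m\<le>n. ?Y m \<omega> = i m \<and> ennreal (t m) < ?H m \<omega>)"
        then have "\<forall>m\<le>n. ?Y m \<omega> = i m \<and> ennreal (t m) < ?H m \<omega>" by simp
        from this[rule_format, of 0] this[rule_format, of 1]
        show "\<omega> 0 \<in> {t 0<..} \<and> shock_state \<omega> = i 1"
          using False it by (auto simp: ennreal_less_iff)
      next
        fix \<omega> assume *: "\<omega> 0 \<in> {t 0<..} \<and> shock_state \<omega> = i 1"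
        have "?Y m \<omega> = i m" if "m \<le> n" for m
          using * True that frozenD[of i n m] by (cases "m = 0") auto
        moreover have "ennreal (t 0) < ennreal (\<omega> 0)"
          using * it by (auto simp: ennreal_less_iff)
        ultimately show "\<omega> \<in> space sample \<and> (\<forall>m\<le>n. ?Y m \<omega> = i m \<and> ennreal (t m) < ?H m \<omega>)"
          by (auto simp: space_sample)
      qed
      then have "measure sample {\<omega> \<in> space sample. \<forall>m\<le>n. ?Y m \<omega> = i m \<and> ennreal (t m) < ?H m \<omega>} =
          exp (L (i 0) (i 0) * t 0) * measure D {i 1}"
        using indep_shock[of "{t 0<..}" "i 1"] tail by simp
      also have "\<dots> = measure D {i 1} * (\<Prod>m\<le>n. exp (L (i m) (i m) * t m))"
      proof (cases "i 1 \<in> S")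
        case True1: True
        have "(\<Prod>m\<le>n. exp (L (i m) (i m) * t m)) = (\<Prod>m\<in>{0}. exp (L (i m) (i m) * t m))"
        proof (rule prod.mono_neutral_right)
          show "\<forall>m\<in>{..n} - {0}. exp (L (i m) (i m) * t m) = 1"
          proof
            fix m assume "m \<in> {..n} - {0}"
            then have "i m \<in> S" using frozenD[of i n m] True True1 by auto
            then show "exp (L (i m) (i m) * t m) = 1" by (simp add: L_S)
          qed
        qed auto
        then show ?thesis by simp
      qed (simp add: mass_outside)
      also have "measure D {i 1} = ?jump i n"
        using True False it by (subst jumps) auto
      finally show ?thesis .
    qed
  qed
  have paths: "AE \<omega> in sample. \<forall>t\<ge>0. \<forall>n. (\<Sum>m<n. ?H m \<omega>) \<le> ennreal t \<and>
      ennreal t < (\<Sum>m\<le>n. ?H m \<omega>) \<longrightarrow> pre_shock t \<omega> = ?Y n \<omega>"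
  proof (intro AE_I2 allI impI, elim conjE)
    fix \<omega> t n
    assume t: "0 \<le> t" and lower: "(\<Sum>m<n. ?H m \<omega>) \<le> ennreal t" and upper: "ennreal t < (\<Sum>m\<le>n. ?H m \<omega>)"
    have "\<not> 1 < n"
    proof
      assume "1 < n"
      then have "?H 1 \<omega> \<le> (\<Sum>m<n. ?H m \<omega>)"
        by (intro member_le_sum) auto
      then have "\<infinity> \<le> ennreal t"
        using lower by (auto dest: order_trans)
      then show False
        by (simp add: top_unique)
    qed
    then consider "n = 0" | "n = 1" by linarith
    then show "pre_shock t \<omega> = ?Y n \<omega>"
      using t lower upper by cases (auto simp: pre_shock_def ennreal_less_iff)
  qed
  have meas: "pre_shock t \<in> sample \<rightarrow>\<^sub>M count_space ({e} \<union> S)" for t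
  proof -
    have "pre_shock t \<in> sample \<rightarrow>\<^sub>M count_space UNIV"
      unfolding pre_shock_def by measurable
    then show ?thesis
      using shock_state_in by (subst measurable_count_space_extend) (auto simp: pre_shock_def)
  qed
  show ?thesis
    unfolding markov_jump_process_def L_def[symmetric]
  proof (intro conjI exI[of _ ?Y] exI[of _ ?H])
    show "\<forall>n i t. (\<forall>m\<le>n. i m \<in> {e} \<union> S \<and> 0 \<le> t m) \<longrightarrow>
       measure sample {\<omega> \<in> space sample. \<forall>m\<le>n. ?Y m \<omega> = i m \<and> ennreal (t m) < ?H m \<omega>} =
       ?jump i n * (\<Prod>m\<le>n. exp (L (i m) (i m) * t m))"
      using law by blast
    show "\<forall>n. ?Y n \<in> sample \<rightarrow>\<^sub>M count_space ({e} \<union> S)"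
    proof
      fix n show "?Y n \<in> sample \<rightarrow>\<^sub>M count_space ({e} \<union> S)"
        using measurable_compose[OF measurable_shock_state_S, of id "count_space ({e} \<union> S)"] by (cases n) auto
    qed
    show "\<forall>t\<ge>0. pre_shock t \<in> sample \<rightarrow>\<^sub>M count_space ({e} \<union> S)"
      using meas by blast
    show "\<forall>n. ?H n \<in> borel_measurable sample"
      by (intro allI) measurable
    show "AE \<omega> in sample. \<forall>t\<ge>0. \<forall>n. (\<Sum>m<n. ?H m \<omega>) \<le> ennreal t \<and>
        ennreal t < (\<Sum>m\<le>n. ?H m \<omega>) \<longrightarrow> pre_shock t \<omega> = ?Y n \<omega>"
      by (rule paths)
  qed (simp_all add: finite_S sample.prob_space_axioms)
qed

end

section \<open>The processes after the common shock\<close>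

lemma (in prob_space) indep_vars_reindex:
  assumes "inj f" and ind: "indep_vars (\<lambda>_. N) X UNIV"
  shows "indep_vars (\<lambda>_. N) (\<lambda>m. X (f m)) UNIV"
  unfolding indep_vars_def2
proof (intro conjI ballI indep_setsI)
  have rv: "random_variable N (X i)" for i
    using ind by (auto simp: indep_vars_def2)
  show "random_variable N (X (f m))" for m by (rule rv)
  show "{X (f m) -` A \<inter> space M |A. A \<in> sets N} \<subseteq> events" for m
    using rv by auto
  fix A J assume J: "J \<noteq> {}" "finite J" and A: "\<forall>j\<in>J. A j \<in> {X (f j) -` A \<inter> space M |A. A \<in> sets N}"
  have inj: "inj_on f J" using \<open>inj f\<close> by (auto simp: inj_on_def)
  have g: "the_inv f (f j) = j" for j using \<open>inj f\<close> by (rule the_inv_f_f)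
  have "prob (\<Inter>i\<in>f ` J. A (the_inv f i)) = (\<Prod>i\<in>f ` J. prob (A (the_inv f i)))"
  proof (rule indep_setsD)
    show "indep_sets (\<lambda>i. {X i -` A \<inter> space M |A. A \<in> sets N}) UNIV"
      using ind by (simp add: indep_vars_def2)
  qed (use J A g in auto)
  then show "prob (\<Inter>j\<in>J. A j) = (\<Prod>j\<in>J. prob (A j))"
    by (simp add: prod.reindex[OF inj] g)
qed

context common_shock
begin

definition conditional_law :: "nat \<Rightarrow> nat \<Rightarrow> real measure" where
  "conditional_law k = coordinate_law(1 := uniform_measure (coordinate_law 1) (decode_state -` {k}))"

definition sample_given :: "nat \<Rightarrow> (nat \<Rightarrow> real) measure" where
  "sample_given k = uniform_measure sample {\<omega> \<in> space sample. shock_state \<omega> = k}"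

lemma shock_state_event: "{\<omega> \<in> space sample. shock_state \<omega> = k} \<in> sets sample"
  by measurable

context
  fixes k assumes k_mass: "measure sample {\<omega> \<in> space sample. shock_state \<omega> = k} > 0"
begin

lemma shock_state_emeasure: "emeasure sample {\<omega> \<in> space sample. shock_state \<omega> = k} \<noteq> 0"
  using k_mass by (simp add: sample.emeasure_eq_measure)

lemma decode_state_mass: "emeasure (coordinate_law 1) (decode_state -` {k}) \<noteq> 0"
proof -
  interpret product_prob_space coordinate_law UNIV
    by (intro product_prob_spaceI prob_coordinate_law)
  have "emeasure sample {\<omega> \<in> space sample. \<omega> 1 \<in> decode_state -` {k}} = emeasure (coordinate_law 1) (decode_state -` {k})"
    unfolding sample_def by (rule emeasure_PiM_Collect_single) (auto simp: sets_coordinate_law decode_state_vimage)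
  then show ?thesis
    using shock_state_emeasure by (simp add: shock_state_def)
qed

lemma prob_conditional_law: "prob_space (conditional_law k i)"
  using decode_state_mass prob_coordinate_law[of 1]
    prob_space.finite_measure[OF prob_coordinate_law, THEN finite_measure.emeasure_finite]
  by (auto simp: conditional_law_def prob_coordinate_law intro!: prob_space_uniform_measure)

lemma sets_conditional_law: "sets (conditional_law k i) = sets borel"
  by (simp add: conditional_law_def sets_coordinate_law)

lemma sample_given_eq: "sample_given k = PiM UNIV (conditional_law k)"
  using uniform_measure_PiM_coordinate[of coordinate_law 1 UNIV "decode_state -` {k}"]
    prob_coordinate_law decode_state_mass decode_state_vimage
  by (simp add: sample_given_def sample_def conditional_law_def shock_state_def sets_coordinate_law)

lemma sets_sample_given: "sets (sample_given k) = sets sample"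
  by (simp add: sample_given_def)

lemma space_sample_given: "space (sample_given k) = UNIV"
  by (simp add: sample_given_def space_sample)

lemma prob_sample_given: "prob_space (sample_given k)"
  unfolding sample_given_eq by (rule prob_space_PiM) (rule prob_conditional_law)

lemma AE_sample_given: "AE \<omega> in sample_given k. shock_state \<omega> = k"
  unfolding sample_given_def by (rule AE_uniform_measureI[OF shock_state_event]) simp

lemma indep_coordinates_given:
  "prob_space.indep_vars (sample_given k) (\<lambda>_. borel) (\<lambda>i \<omega>. \<omega> i) UNIV"
  unfolding sample_given_eq
  by (rule indep_vars_PiM_coordinates) (auto simp: prob_conditional_law sets_conditional_law)

lemma indep_holding_given:
  "prob_space.indep_vars (sample_given k) (\<lambda>_. borel) (\<lambda>m \<omega>. \<omega> (2 * m + b)) UNIV"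
  by (rule prob_space.indep_vars_reindex[OF prob_sample_given _ indep_coordinates_given]) (simp add: inj_def)

lemma exponential_holding_given:
  "2 \<le> b \<Longrightarrow> distributed (sample_given k) lborel (\<lambda>\<omega>. \<omega> (2 * m + b)) (exponential_density r)"
  unfolding sample_given_eq
  by (rule exponential_coordinate[OF prob_conditional_law]) (simp add: conditional_law_def coordinate_law_def)

end

context
  fixes h d :: "nat \<Rightarrow> nat" and b :: nat
  assumes cd: "countdown S h d r" and b: "2 \<le> b"
begin

interpretation countdown S h d r by (rule cd)

lemma post_shock_eq: "post_shock h d b t \<omega> = trajectory (shock_state \<omega>) (\<lambda>m. \<omega> (2 * m + b)) t"
  by (simp add: post_shock_def)

lemma measurable_post_shock: "post_shock h d b t \<in> sample \<rightarrow>\<^sub>M count_space (absorbing_states S)"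
  unfolding post_shock_eq[abs_def]
  by (rule measurable_compose_countable'[OF _ measurable_shock_state_S])
     (auto intro: measurable_trajectory countable_finite finite_S)

lemma exit_time_post_shock:
  "exit_time (post_shock h d b) (Some ` S) \<omega> = (\<Sum>m\<le>h (shock_state \<omega>). max 0 (\<omega> (2 * m + b)))"
  unfolding exit_time_def post_shock_eq by (rule absorption_time[OF shock_state_in])

lemma measurable_exit_time_post_shock: "exit_time (post_shock h d b) (Some ` S) \<in> borel_measurable sample"
  unfolding exit_time_post_shock[abs_def]
  by (rule measurable_compose_countable[OF _ measurable_shock_state]) measurable

lemma markov_jump_process_post_shock:
  assumes k: "k \<in> S" and mass: "measure sample {\<omega> \<in> space sample. shock_state \<omega> = k} > 0"
  shows "markov_jump_process (sample_given k) (absorbing_states S) (\<lambda>x. if x = Some k then 1 else 0)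
     (absorbing_intensity S rates) (post_shock h d b)"
proof (rule markov_jump_process_trajectory[OF prob_sample_given[OF mass] k])
  show "AE \<omega> in sample_given k. \<forall>t\<ge>0. post_shock h d b t \<omega> = trajectory k (\<lambda>m. \<omega> (2 * m + b)) t"
    using AE_sample_given[OF mass] by eventually_elim (simp add: post_shock_eq)
  show "post_shock h d b t \<in> sample_given k \<rightarrow>\<^sub>M count_space (absorbing_states S)" for t
    using measurable_post_shock measurable_cong_sets[OF sets_sample_given[OF mass] refl] by blast
qed (use indep_holding_given[OF mass] exponential_holding_given[OF mass b] in auto)

text \<open>Given the shock state \<open>k\<close> the time to absorption is Erlang with mean
  \<open>(h k + 1) / r\<close>, and the bound of Chebyshev's inequality is uniform in \<open>k\<close>; averaging over
  the finitely many states gives the unconditional estimate.\<close>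
lemma post_shock_deviation:
  assumes d: "0 < \<delta>" and H: "\<And>k. k \<in> S \<Longrightarrow> h k \<le> H"
  shows "measure sample {\<omega>. \<delta> \<le> \<bar>exit_time (post_shock h d b) (Some ` S) \<omega> - real (h (shock_state \<omega>) + 1) / r\<bar>}
     \<le> real (H + 1) / (r * \<delta>)\<^sup>2"
proof -
  define f where "f \<omega> = exit_time (post_shock h d b) (Some ` S) \<omega> - real (h (shock_state \<omega>) + 1) / r" for \<omega>
  have [measurable]: "f \<in> borel_measurable sample"
    unfolding f_def
    by (intro borel_measurable_diff measurable_exit_time_post_shock measurable_compose[OF measurable_shock_state]) auto
  let ?A = "{\<omega>. \<delta> \<le> \<bar>exit_time (post_shock h d b) (Some ` S) \<omega> - real (h (shock_state \<omega>) + 1) / r\<bar>}"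
  let ?K = "\<lambda>k. {\<omega> \<in> space sample. shock_state \<omega> = k}"
  have "{\<omega> \<in> space sample. \<delta> \<le> \<bar>f \<omega>\<bar>} \<in> sets sample"
    by measurable
  then have A[measurable]: "?A \<in> sets sample"
    by (simp add: space_sample f_def)
  \<comment> \<open>Proved as a product, so that states of probability zero need no conditional law.\<close>
  have cond: "measure sample (?K k \<inter> ?A) \<le> measure sample (?K k) * (real (H + 1) / (r * \<delta>)\<^sup>2)" if k: "k \<in> S" for k
  proof (cases "measure sample (?K k) > 0")
    case False
    then have "measure sample (?K k) = 0"
      using measure_nonneg[of sample "?K k"] by linarith
    then show ?thesis
      using sample.finite_measure_mono[of "?K k \<inter> ?A" "?K k"] shock_state_event by auto
  next
    case True
    interpret N: prob_space "sample_given k" by (rule prob_sample_given[OF True])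
    have "measure sample (?K k \<inter> ?A) / measure sample (?K k) = measure (sample_given k) ?A"
      unfolding sample_given_def
      by (subst measure_uniform_measure[OF _ _ A]) (use True in \<open>auto simp: sample.emeasure_eq_measure\<close>)
    also have "\<dots> = measure (sample_given k) {\<omega>. \<delta> \<le> \<bar>(\<Sum>m\<le>h k. max 0 (\<omega> (2 * m + b))) - real (h k + 1) / r\<bar>}"
    proof (rule N.finite_measure_eq_AE)
      show "AE \<omega> in sample_given k. \<omega> \<in> ?A \<longleftrightarrow>
          \<omega> \<in> {\<omega>. \<delta> \<le> \<bar>(\<Sum>m\<le>h k. max 0 (\<omega> (2 * m + b))) - real (h k + 1) / r\<bar>}"
        using AE_sample_given[OF True] by eventually_elim (simp add: exit_time_post_shock)
      have "{\<omega> \<in> space sample. \<delta> \<le> \<bar>(\<Sum>m\<le>h k. max 0 (\<omega> (2 * m + b))) - real (h k + 1) / r\<bar>} \<in> sets sample"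
        by measurable
      then show "{\<omega>. \<delta> \<le> \<bar>(\<Sum>m\<le>h k. max 0 (\<omega> (2 * m + b))) - real (h k + 1) / r\<bar>} \<in> sets (sample_given k)"
        by (simp add: space_sample sets_sample_given[OF True])
      show "?A \<in> sets (sample_given k)"
        using A by (simp only: sets_sample_given[OF True])
    qed
    also have "\<dots> \<le> real (h k + 1) / (r * \<delta>)\<^sup>2"
      using N.exponential_sum_deviation[OF r_pos d indep_holding_given[OF True] exponential_holding_given[OF True b], of "h k"]
      by (simp add: space_sample_given[OF True])
    also have "\<dots> \<le> real (H + 1) / (r * \<delta>)\<^sup>2"
      using H[OF k] by (intro divide_right_mono) auto
    finally show ?thesis
      using True by (simp add: divide_le_eq mult.commute)
  qed
  have "?A = (\<Union>k\<in>S. ?K k \<inter> ?A)"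
    using shock_state_in by (auto simp: space_sample)
  then have "measure sample ?A = measure sample (\<Union>k\<in>S. ?K k \<inter> ?A)"
    by (rule arg_cong)
  also have "\<dots> = (\<Sum>k\<in>S. measure sample (?K k \<inter> ?A))"
    using finite_S shock_state_event A
    by (intro sample.finite_measure_finite_Union) (auto simp: disjoint_family_on_def)
  also have "\<dots> \<le> (\<Sum>k\<in>S. measure sample (?K k) * (real (H + 1) / (r * \<delta>)\<^sup>2))"
    by (intro sum_mono cond)
  also have "\<dots> = (\<Sum>k\<in>S. measure D {k}) * (real (H + 1) / (r * \<delta>)\<^sup>2)"
    unfolding sum_distrib_right using measure_shock_state[of "{k}" for k]
    by (intro sum.cong refl arg_cong2[where f="(*)"]) (simp add: space_sample)
  also have "\<dots> = real (H + 1) / (r * \<delta>)\<^sup>2"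
    by (simp add: sum_mass)
  finally show ?thesis .
qed

text \<open>On the event that the shock state is \<open>k\<close> the path is the countdown trajectory from the fixed
  state \<open>k\<close>, which is measurable for the coordinates of its block alone.\<close>
lemma process_events_post_shock:
  assumes k: "k \<in> S" and mass: "measure sample {\<omega> \<in> space sample. shock_state \<omega> = k} > 0"
    and I: "range (\<lambda>m. 2 * m + b) \<subseteq> I"
    and A: "A \<in> process_events (sample_given k) (post_shock h d b)"
  shows "\<exists>B\<in>sigma_sets UNIV (\<Union>i\<in>I. {(\<lambda>\<omega>. \<omega> i) -` A |A. A \<in> sets borel}).
    AE \<omega> in sample_given k. \<omega> \<in> A \<longleftrightarrow> \<omega> \<in> B"
proof (rule sigma_sets_AE_representative[OF _ _ A[unfolded process_events_def]])
  let ?E = "\<Union>i\<in>I. {(\<lambda>\<omega>::nat \<Rightarrow> real. \<omega> i) -` A |A. A \<in> sets borel}"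
  show "sigma_algebra (space (sample_given k)) (sigma_sets UNIV ?E)"
    by (simp add: space_sample_given[OF mass] sigma_algebra_sigma_sets)
  fix A' assume "A' \<in> {post_shock h d b t -` A \<inter> space (sample_given k) |t A. 0 \<le> t}"
  then obtain t A where A': "A' = post_shock h d b t -` A" "0 \<le> t"
    by (auto simp: space_sample_given[OF mass])
  let ?G = "sigma UNIV ?E"
  have coord: "(\<lambda>\<omega>. \<omega> (2 * m + b)) \<in> borel_measurable ?G" for m
  proof (rule measurableI)
    fix B :: "real set" assume "B \<in> sets borel"
    then show "(\<lambda>\<omega>. \<omega> (2 * m + b)) -` B \<inter> space ?G \<in> sets ?G"
      using I by (auto simp: space_measure_of_conv sets_measure_of_conv intro!: sigma_sets.Basic)
  qed simp
  let ?B = "(\<lambda>\<omega>. trajectory k (\<lambda>m. \<omega> (2 * m + b)) t) -` (A \<inter> absorbing_states S) \<inter> space ?G"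
  have "?B \<in> sets ?G"
    by (rule measurable_sets[OF measurable_trajectory[OF k coord]]) simp
  then have "?B \<in> sigma_sets UNIV ?E"
    by (simp add: sets_measure_of_conv)
  moreover
  have in_states: "trajectory k c t \<in> absorbing_states S" for c
    unfolding trajectory_def by (rule chain_in[OF k])
  have "AE \<omega> in sample_given k. \<omega> \<in> A' \<longleftrightarrow> \<omega> \<in> ?B"
    using AE_sample_given[OF mass] by eventually_elim (auto simp: A' post_shock_eq space_measure_of_conv in_states)
  ultimately show "\<exists>B\<in>sigma_sets UNIV ?E. AE \<omega> in sample_given k. \<omega> \<in> A' \<longleftrightarrow> \<omega> \<in> B"
    by blast
qed

lemma process_events_post_shock_subset:
  "process_events (sample_given k) (post_shock h d b) \<subseteq> sets (sample_given k)"
  using measurable_post_shock 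
    measurable_cong_sets[of "sample_given k" sample, OF _ refl]
  by (intro process_events_subset[where I="absorbing_states S"]) (auto simp: sample_given_def)

end

end

section \<open>The common-shock construction\<close>

context common_shock
begin

text \<open>Given the shock state, the shock time is a function of coordinate 0 and the two processes are, up to null
  sets, functions of the even and the odd coordinates from 2 on. These three blocks are disjoint.\<close>
lemma csph_construction_countdowns:
  assumes c1: "countdown S h1 d1 r" and c2: "countdown S h2 d2 r"
  shows "csph_construction sample pre_shock (post_shock h1 d1 2) (post_shock h2 d2 3) {e} S
     (\<lambda>_. 1) (\<lambda>_ _. - l) (\<lambda>_ k. l * measure D {k}) (countdown.rates h1 d1 r) (countdown.rates h2 d2 r)"
proof -
  have exit_meas: "(\<lambda>\<omega>. max 0 (\<omega> 0)) \<in> borel_measurable sample"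
    by measurable
  have state_meas: "shock_state \<in> sample \<rightarrow>\<^sub>M count_space ({e} \<union> S)"
    by (rule measurable_count_space_extend[OF subset_UNIV _ measurable_shock_state])
       (auto simp: shock_state_in)
  have indep: "prob_space.indep_sets (sample_given k)
      (\<lambda>n::nat. if n = 0 then variable_events (sample_given k) (\<lambda>\<omega>. max 0 (\<omega> 0))
         else if n = 1 then process_events (sample_given k) (post_shock h1 d1 2)
         else process_events (sample_given k) (post_shock h2 d2 3)) {0, 1, 2}"
    if k: "k \<in> S" and mass: "measure sample {\<omega> \<in> space sample. shock_state \<omega> = k} > 0" for k
  proof -
    interpret N: prob_space "sample_given k" by (rule prob_sample_given[OF mass])
    define I :: "nat \<Rightarrow> nat set" where "I j = (if j = 0 then {0} else if j = 1 then range (\<lambda>m. 2 * m + 2) else range (\<lambda>m. 2 * m + 3))" for j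
    let ?E = "\<lambda>i. {(\<lambda>\<omega>::nat \<Rightarrow> real. \<omega> i) -` A |A. A \<in> sets borel}"
    have "N.indep_sets ?E UNIV"
      using indep_coordinates_given[OF mass] by (simp add: N.indep_vars_def2 space_sample_given[OF mass])
    then have "N.indep_sets ?E (\<Union>j\<in>{0, 1, 2}. I j)"
      by (rule N.indep_sets_mono_index[rotated]) simp
    then have "N.indep_sets (\<lambda>j. sigma_sets (space (sample_given k)) (\<Union>i\<in>I j. ?E i)) {0, 1, 2}"
    proof (rule N.indep_sets_collect_sigma)
      show "Int_stable (?E i)" for i
      proof (rule Int_stableI)
        fix a b assume "a \<in> ?E i" "b \<in> ?E i"
        then obtain A B where "A \<in> sets borel" "B \<in> sets borel"
            "a = (\<lambda>\<omega>. \<omega> i) -` A" "b = (\<lambda>\<omega>. \<omega> i) -` B" by blast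
        then have "A \<inter> B \<in> sets borel" "a \<inter> b = (\<lambda>\<omega>. \<omega> i) -` (A \<inter> B)" by auto
        then show "a \<inter> b \<in> ?E i" by blast
      qed
      show "disjoint_family_on I {0, 1, 2}"
        by (auto simp: disjoint_family_on_def I_def) presburger+
    qed
    then show ?thesis
    proof (rule N.indep_sets_AE_representatives)
      fix j :: nat assume "j \<in> {0, 1, 2}"
      then consider "j = 0" | "j = 1" | "j = 2" by auto
      note j = this
      show "(if j = 0 then variable_events (sample_given k) (\<lambda>\<omega>. max 0 (\<omega> 0))
         else if j = 1 then process_events (sample_given k) (post_shock h1 d1 2)
         else process_events (sample_given k) (post_shock h2 d2 3)) \<subseteq> N.events"
        using j
      proof cases
        case 1
        then show ?thesis
          using measurable_sets[OF exit_meas]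
          by (auto simp: variable_events_def sets_sample_given[OF mass] space_sample_given[OF mass] space_sample)
      qed (use process_events_post_shock_subset[OF c1] process_events_post_shock_subset[OF c2] in simp_all)
      fix A assume A: "A \<in> (if j = 0 then variable_events (sample_given k) (\<lambda>\<omega>. max 0 (\<omega> 0))
         else if j = 1 then process_events (sample_given k) (post_shock h1 d1 2)
         else process_events (sample_given k) (post_shock h2 d2 3))"
      show "\<exists>B\<in>sigma_sets (space (sample_given k)) (\<Union>i\<in>I j. ?E i). AE \<omega> in sample_given k. \<omega> \<in> A \<longleftrightarrow> \<omega> \<in> B"
        using j
      proof cases
        case 1
        then obtain B where B: "B \<in> sets borel" "A = (\<lambda>\<omega>::nat \<Rightarrow> real. max 0 (\<omega> 0)) -` B"
          using A by (auto simp: variable_events_def space_sample_given[OF mass])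
        have "max 0 -` B \<in> sets borel"
          using measurable_sets[of "max (0::real)" borel borel B] B by simp
        then have "(\<lambda>\<omega>::nat \<Rightarrow> real. \<omega> 0) -` (max 0 -` B) \<in> ?E 0" by blast
        moreover have "A = (\<lambda>\<omega>::nat \<Rightarrow> real. \<omega> 0) -` (max 0 -` B)" using B by auto
        ultimately have "A \<in> sigma_sets (space (sample_given k)) (\<Union>i\<in>I j. ?E i)"
          using 1 by (intro sigma_sets.Basic) (simp add: I_def)
        then show ?thesis by (intro bexI[of _ A]) auto
      next
        case 2
        then show ?thesis
          using process_events_post_shock[OF c1 _ k mass, of 2 "I j" A] A
          by (simp add: space_sample_given[OF mass] I_def)
      next
        case 3
        then show ?thesis
          using process_events_post_shock[OF c2 _ k mass, of 3 "I j" A] A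
          by (simp add: space_sample_given[OF mass] I_def)
      qed
    qed
  qed
  show ?thesis
    unfolding csph_construction_def Let_def exit_time_pre_shock pre_shock_at_exit
    using markov_jump_process_pre_shock exit_meas state_meas
      measurable_exit_time_post_shock[OF c1, of 2] measurable_exit_time_post_shock[OF c2, of 3]
      markov_jump_process_post_shock[OF c1, of 2] markov_jump_process_post_shock[OF c2, of 3] indep[unfolded sample_given_def]
    by (simp add: sample_given_def)
qed

lemma csph_parameters_countdowns:
  assumes c1: "countdown S h1 d1 r" and c2: "countdown S h2 d2 r" and a: "0 < a1" "0 < a2"
  shows "csph_parameters {e} S (\<lambda>_. 1) (\<lambda>_ _. - l) (\<lambda>_ k. l * measure D {k})
     (countdown.rates h1 d1 r) (countdown.rates h2 d2 r) a1 a2"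
proof -
  have "(\<Sum>k\<in>S. l * measure D {k}) = l"
    by (simp add: sum_distrib_left[symmetric] sum_mass)
  then show ?thesis
    using l_pos e_notin finite_S S_nonempty a
      countdown.subintensity_rates[OF c1] countdown.nonsingular_rates[OF c1]
      countdown.subintensity_rates[OF c2] countdown.nonsingular_rates[OF c2]
    by (auto simp: csph_parameters_def probability_vector_def subintensity_matrix_def nonsingular_on_def)
qed

text \<open>Outside three unlikely events both \<open>X1\<close> and \<open>X2\<close> are within
  \<open>2 \<delta>\<close> of the conditional means: one \<open>\<delta>\<close> for each Erlang time and one for the
  scaled shock time. The upper bound on the distribution function does not involve the shock time, as that only
  increases \<open>X1\<close> and \<open>X2\<close>.\<close>
lemma csph_near_grid_law:
  assumes c1: "countdown S h1 d1 r" and c2: "countdown S h2 d2 r" and a: "0 < a1" "0 < a2"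
    and H: "\<And>k. k \<in> S \<Longrightarrow> h1 k \<le> H" "\<And>k. k \<in> S \<Longrightarrow> h2 k \<le> H"
  obtains \<mu> where "csph_distribution a1 a2 \<mu>"
    and "\<And>x y \<delta>. 0 < \<delta> \<Longrightarrow>
      bivariate_cdf \<mu> (x, y) \<le>
        measure D {k. real (h1 k + 1) / r \<le> x + \<delta> \<and> real (h2 k + 1) / r \<le> y + \<delta>}
          + 2 * real (H + 1) / (r * \<delta>)\<^sup>2"
    and "\<And>x y \<delta>. 0 < \<delta> \<Longrightarrow>
      measure D {k. real (h1 k + 1) / r \<le> x - 2 * \<delta> \<and> real (h2 k + 1) / r \<le> y - 2 * \<delta>}
        \<le> bivariate_cdf \<mu> (x, y) + 2 * real (H + 1) / (r * \<delta>)\<^sup>2 + exp (- (\<delta> / max a1 a2) * l)"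
proof -
  define T0 :: "(nat \<Rightarrow> real) \<Rightarrow> real" where "T0 \<omega> = max 0 (\<omega> 0)" for \<omega>
  define T1 where "T1 = exit_time (post_shock h1 d1 2) (Some ` S)"
  define T2 where "T2 = exit_time (post_shock h2 d2 3) (Some ` S)"
  define g1 where "g1 k = real (h1 k + 1) / r" for k
  define g2 where "g2 k = real (h2 k + 1) / r" for k
  define \<mu> where "\<mu> = distr sample borel (\<lambda>\<omega>. (a1 * T0 \<omega> + T1 \<omega>, a2 * T0 \<omega> + T2 \<omega>))"
  have [measurable]: "T0 \<in> borel_measurable sample" "T1 \<in> borel_measurable sample" "T2 \<in> borel_measurable sample"
    using measurable_exit_time_post_shock[OF c1, of 2] measurable_exit_time_post_shock[OF c2, of 3]
    by (simp_all add: T0_def[abs_def] T1_def T2_def)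
  have [measurable]: "(\<lambda>\<omega>. g1 (shock_state \<omega>)) \<in> borel_measurable sample" "(\<lambda>\<omega>. g2 (shock_state \<omega>)) \<in> borel_measurable sample"
    by (auto intro: measurable_compose[OF measurable_shock_state])
  have law: "csph_law {e} S (\<lambda>_. 1) (\<lambda>_ _. - l) (\<lambda>_ k. l * measure D {k})
     (countdown.rates h1 d1 r) (countdown.rates h2 d2 r) a1 a2 \<mu>"
    unfolding csph_law_def
    by (intro exI conjI, rule csph_construction_countdowns[OF c1 c2])
       (simp add: \<mu>_def T0_def T1_def T2_def exit_time_pre_shock)
  have csph: "csph_distribution a1 a2 \<mu>"
    unfolding csph_distribution_def
    by (intro exI conjI, rule csph_parameters_countdowns[OF c1 c2 a], rule law)
  let ?X = "\<lambda>x y. {\<omega>. a1 * T0 \<omega> + T1 \<omega> \<le> x \<and> a2 * T0 \<omega> + T2 \<omega> \<le> y}"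
  let ?G = "\<lambda>x y. {\<omega>. g1 (shock_state \<omega>) \<le> x \<and> g2 (shock_state \<omega>) \<le> y}"
  \<comment> \<open>The bad events: a deviation of either Erlang time, and a late shock.\<close>
  let ?B1 = "\<lambda>\<delta>. {\<omega>. \<delta> \<le> \<bar>T1 \<omega> - g1 (shock_state \<omega>)\<bar>}"
  let ?B2 = "\<lambda>\<delta>. {\<omega>. \<delta> \<le> \<bar>T2 \<omega> - g2 (shock_state \<omega>)\<bar>}"
  let ?B0 = "\<lambda>\<delta>. {\<omega>. \<delta> / max a1 a2 < \<omega> 0}"
  have ev: "{\<omega>. P \<omega>} \<in> sets sample" if "Measurable.pred sample P" for P
    using that by (simp add: pred_def space_sample)
  have ev_X: "?X x y \<in> sets sample" and ev_G: "?G x y \<in> sets sample" for x y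
    by (rule ev, measurable)+
  have ev_B: "?B1 \<delta> \<in> sets sample" "?B2 \<delta> \<in> sets sample" "?B0 \<delta> \<in> sets sample" for \<delta>
    by (rule ev, measurable)+
  have cdf: "bivariate_cdf \<mu> (x, y) = measure sample (?X x y)" for x y
  proof -
    have "bivariate_cdf \<mu> (x, y) = measure sample ((\<lambda>\<omega>. (a1 * T0 \<omega> + T1 \<omega>, a2 * T0 \<omega> + T2 \<omega>)) -` ({..x} \<times> {..y}) \<inter> space sample)"
      unfolding \<mu>_def bivariate_cdf_def
      by (simp, subst measure_distr) (auto simp: borel_prod[symmetric])
    also have "(\<lambda>\<omega>. (a1 * T0 \<omega> + T1 \<omega>, a2 * T0 \<omega> + T2 \<omega>)) -` ({..x} \<times> {..y}) \<inter> space sample = ?X x y"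
      by (auto simp: space_sample)
    finally show ?thesis .
  qed
  have grid: "measure sample (?G x y) = measure D {k. g1 k \<le> x \<and> g2 k \<le> y}" for x y
    using measure_shock_state[of "{k. g1 k \<le> x \<and> g2 k \<le> y}"] by simp
  have dev: "measure sample (?B1 \<delta>) \<le> real (H + 1) / (r * \<delta>)\<^sup>2" "measure sample (?B2 \<delta>) \<le> real (H + 1) / (r * \<delta>)\<^sup>2"
    if "0 < \<delta>" for \<delta>
    using post_shock_deviation[OF c1 _ that H(1), of 2] post_shock_deviation[OF c2 _ that H(2), of 3]
    by (simp_all add: T1_def T2_def g1_def g2_def)
  have shock: "measure sample (?B0 \<delta>) = exp (- (\<delta> / max a1 a2) * l)" if "0 < \<delta>" for \<delta>
    using that a by (intro exponential_tail_coordinate) (auto simp: coordinate_law_def l_pos)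
  show thesis
  proof (rule that[OF csph])
    fix x y \<delta> :: real assume \<delta>: "0 < \<delta>"
    have "?X x y \<subseteq> ?G (x + \<delta>) (y + \<delta>) \<union> (?B1 \<delta> \<union> ?B2 \<delta>)"
    proof
      fix \<omega> assume \<omega>: "\<omega> \<in> ?X x y"
      have "0 \<le> a1 * T0 \<omega>" "0 \<le> a2 * T0 \<omega>" using a by (auto simp: T0_def)
      with \<omega> show "\<omega> \<in> ?G (x + \<delta>) (y + \<delta>) \<union> (?B1 \<delta> \<union> ?B2 \<delta>)" by auto
    qed
    then have le: "measure sample (?X x y) \<le> measure sample (?G (x + \<delta>) (y + \<delta>) \<union> (?B1 \<delta> \<union> ?B2 \<delta>))"
      using ev_G ev_B by (intro sample.finite_measure_mono) auto
    have le1: "measure sample (?G (x + \<delta>) (y + \<delta>) \<union> (?B1 \<delta> \<union> ?B2 \<delta>)) \<le> measure sample (?G (x + \<delta>) (y + \<delta>)) + measure sample (?B1 \<delta> \<union> ?B2 \<delta>)"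
      using ev_G ev_B by (intro measure_Un_le) auto
    have le2: "measure sample (?B1 \<delta> \<union> ?B2 \<delta>) \<le> measure sample (?B1 \<delta>) + measure sample (?B2 \<delta>)"
      using ev_B by (intro measure_Un_le) auto
    have "measure sample (?X x y) \<le> measure sample (?G (x + \<delta>) (y + \<delta>)) + 2 * real (H + 1) / (r * \<delta>)\<^sup>2"
      using le le1 le2 dev[OF \<delta>] by linarith
    then show "bivariate_cdf \<mu> (x, y) \<le>
        measure D {k. real (h1 k + 1) / r \<le> x + \<delta> \<and> real (h2 k + 1) / r \<le> y + \<delta>}
          + 2 * real (H + 1) / (r * \<delta>)\<^sup>2"
      unfolding cdf grid unfolding g1_def g2_def .
  next
    fix x y \<delta> :: real assume \<delta>: "0 < \<delta>"
    have "?G (x - 2 * \<delta>) (y - 2 * \<delta>) \<subseteq> ?X x y \<union> (?B1 \<delta> \<union> ?B2 \<delta> \<union> ?B0 \<delta>)"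
    proof
      fix \<omega> assume \<omega>: "\<omega> \<in> ?G (x - 2 * \<delta>) (y - 2 * \<delta>)"
      have small: "a1 * T0 \<omega> \<le> \<delta> \<and> a2 * T0 \<omega> \<le> \<delta>" if "\<omega> \<notin> ?B0 \<delta>"
      proof -
        have "T0 \<omega> \<le> \<delta> / max a1 a2" using that \<delta> a by (auto simp: T0_def)
        then have "max a1 a2 * T0 \<omega> \<le> \<delta>" using a by (simp add: pos_le_divide_eq mult.commute)
        moreover have "a1 * T0 \<omega> \<le> max a1 a2 * T0 \<omega>" "a2 * T0 \<omega> \<le> max a1 a2 * T0 \<omega>"
          by (auto intro!: mult_right_mono simp: T0_def)
        ultimately show ?thesis by linarith
      qed
      show "\<omega> \<in> ?X x y \<union> (?B1 \<delta> \<union> ?B2 \<delta> \<union> ?B0 \<delta>)"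
      proof (rule ccontr)
        assume n: "\<not> ?thesis"
        then have "\<omega> \<notin> ?B0 \<delta>" by simp
        from small[OF this] n \<omega> show False by auto
      qed
    qed
    then have le: "measure sample (?G (x - 2 * \<delta>) (y - 2 * \<delta>)) \<le> measure sample (?X x y \<union> (?B1 \<delta> \<union> ?B2 \<delta> \<union> ?B0 \<delta>))"
      using ev_X ev_B by (intro sample.finite_measure_mono) auto
    have le1: "measure sample (?X x y \<union> (?B1 \<delta> \<union> ?B2 \<delta> \<union> ?B0 \<delta>)) \<le> measure sample (?X x y) + measure sample (?B1 \<delta> \<union> ?B2 \<delta> \<union> ?B0 \<delta>)"
      using ev_X ev_B by (intro measure_Un_le) auto
    have le3: "measure sample (?B1 \<delta> \<union> ?B2 \<delta> \<union> ?B0 \<delta>) \<le> measure sample (?B1 \<delta> \<union> ?B2 \<delta>) + measure sample (?B0 \<delta>)"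
      using ev_B by (intro measure_Un_le) auto
    have le2: "measure sample (?B1 \<delta> \<union> ?B2 \<delta>) \<le> measure sample (?B1 \<delta>) + measure sample (?B2 \<delta>)"
      using ev_B by (intro measure_Un_le) auto
    have "measure sample (?G (x - 2 * \<delta>) (y - 2 * \<delta>)) \<le> measure sample (?X x y)
        + 2 * real (H + 1) / (r * \<delta>)\<^sup>2 + exp (- (\<delta> / max a1 a2) * l)"
      using le le1 le2 le3 dev[OF \<delta>] shock[OF \<delta>] by linarith
    then show "measure D {k. real (h1 k + 1) / r \<le> x - 2 * \<delta> \<and> real (h2 k + 1) / r \<le> y - 2 * \<delta>}
        \<le> bivariate_cdf \<mu> (x, y) + 2 * real (H + 1) / (r * \<delta>)\<^sup>2 + exp (- (\<delta> / max a1 a2) * l)"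
      unfolding cdf grid unfolding g1_def g2_def .
  qed
qed

end

section \<open>Discretisation and weak convergence\<close>

text \<open>The complement of the support is a union of open null sets, and by the Lindelof property countably many of
  them cover it.\<close>
lemma AE_in_support:
  fixes \<mu> :: "'a::second_countable_topology measure"
  assumes "finite_measure \<mu>" and sets_\<mu>: "sets \<mu> = sets borel"
  shows "AE z in \<mu>. z \<in> support \<mu>"
proof -
  interpret finite_measure \<mu> by fact
  have null: "V \<in> null_sets \<mu>" if "open V" "measure \<mu> V = 0" for V
    using that by (auto simp: null_sets_def emeasure_eq_measure sets_\<mu>)
  obtain \<V> where \<V>: "\<V> \<subseteq> {V. open V \<and> measure \<mu> V = 0}" "countable \<V>"
      "\<Union>\<V> = \<Union>{V. open V \<and> measure \<mu> V = 0}"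
    using Lindelof[of "{V. open V \<and> measure \<mu> V = 0}"] by auto
  have "- support \<mu> = \<Union>\<V>"
    unfolding \<V>(3) support_def by (auto simp: zero_less_measure_iff)
  moreover have "(\<Union>V\<in>\<V>. V) \<in> null_sets \<mu>"
    using \<V> null by (intro null_sets_UN') auto
  ultimately have "- support \<mu> \<in> null_sets \<mu>" by simp
  then show ?thesis
    by (rule AE_I') auto
qed

text \<open>Pairs of phase numbers coded as positive numbers, so that 0 is free for the state before the
  shock.\<close>
definition grid_state :: "nat \<Rightarrow> nat \<Rightarrow> nat" where
  "grid_state i j = Suc (prod_encode (i, j))"

definition phase1 :: "nat \<Rightarrow> nat" where
  "phase1 k = fst (prod_decode (k - 1))"

definition phase2 :: "nat \<Rightarrow> nat" where
  "phase2 k = snd (prod_decode (k - 1))"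

definition grid :: "nat \<Rightarrow> nat set" where
  "grid N = (\<lambda>(i, j). grid_state i j) ` ({..N} \<times> {..N})"

lemma phases_grid_state[simp]: "phase1 (grid_state i j) = i" "phase2 (grid_state i j) = j"
  by (simp_all add: phase1_def phase2_def grid_state_def)

lemma countdown_grid:
  assumes "0 < r"
  shows "countdown (grid N) phase1 (\<lambda>k. grid_state (phase1 k - 1) (phase2 k)) r"
    and "countdown (grid N) phase2 (\<lambda>k. grid_state (phase1 k) (phase2 k - 1)) r"
  using assms by (auto simp: countdown_def grid_def)

text \<open>The number of the grid cell of \<open>u\<close> for mesh \<open>1 / r\<close>; points beyond
  \<open>N / r\<close> all fall into the last cell, and negative ones into cell 0.\<close>
definition cell :: "real \<Rightarrow> nat \<Rightarrow> real \<Rightarrow> nat" where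
  "cell r N u = min (nat \<lfloor>r * u\<rfloor>) N"

text \<open>Cells are represented by their right end points, so discretisation moves a point upwards unless it lies
  beyond the grid; the assumption \<open>x * r < N\<close> excludes the latter case.\<close>
lemma cell_lower:
  assumes "0 < r" "real (cell r N u + 1) / r \<le> x" "x * r < N"
  shows "u \<le> x"
proof -
  have le: "real (cell r N u) + 1 \<le> x * r"
    using assms by (simp add: pos_divide_le_eq)
  then have "cell r N u < N"
    using assms(3) by linarith
  then have "cell r N u = nat \<lfloor>r * u\<rfloor>"
    by (auto simp: cell_def)
  then have "r * u \<le> r * x"
    using le by (simp add: mult.commute) linarith
  then show ?thesis using assms(1) by simp
qed

lemma cell_upper:
  assumes "0 < r" "0 \<le> u" "u \<le> x - 1 / r"
  shows "real (cell r N u + 1) / r \<le> x"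
proof -
  have "real (cell r N u) \<le> r * u"
  proof -
    have "real (cell r N u) \<le> real (nat \<lfloor>r * u\<rfloor>)" by (simp add: cell_def)
    also have "\<dots> \<le> r * u" using assms by simp
    finally show ?thesis .
  qed
  also have "r * u \<le> r * (x - 1 / r)" using assms by simp
  also have "\<dots> = r * x - 1" using assms by (simp add: right_diff_distrib)
  finally show ?thesis using assms by (simp add: pos_divide_le_eq mult.commute)
qed

text \<open>Of the shift by \<open>3 \<delta>\<close> in the lower bound, \<open>2 \<delta>\<close> come from the
  random times and one \<open>\<delta>\<close> covers the mesh. The upper bound needs \<open>x\<close> and
  \<open>y\<close> to lie well within the grid, since points beyond it are moved towards the origin.\<close>
lemma csph_approximation:
  fixes \<nu> :: "(real \<times> real) measure"
  assumes "prob_space \<nu>" and sets_\<nu>: "sets \<nu> = sets borel"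
    and quadrant: "AE z in \<nu>. z \<in> {0..} \<times> {0..}"
    and a: "0 < a1" "0 < a2" and l: "0 < l" and r: "0 < r"
  obtains \<mu> where "csph_distribution a1 a2 \<mu>"
    and "\<And>x y \<delta>. 0 < \<delta> \<Longrightarrow> (x + \<delta>) * r < N \<Longrightarrow> (y + \<delta>) * r < N \<Longrightarrow>
      bivariate_cdf \<mu> (x, y) \<le> bivariate_cdf \<nu> (x + \<delta>, y + \<delta>) + 2 * real (N + 1) / (r * \<delta>)\<^sup>2"
    and "\<And>x y \<delta>. 1 / r \<le> \<delta> \<Longrightarrow>
      bivariate_cdf \<nu> (x - 3 * \<delta>, y - 3 * \<delta>)
        \<le> bivariate_cdf \<mu> (x, y) + 2 * real (N + 1) / (r * \<delta>)\<^sup>2 + exp (- (\<delta> / max a1 a2) * l)"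
proof -
  interpret \<nu>: prob_space \<nu> by fact
  have [measurable_cong]: "sets \<nu> = sets (borel \<Otimes>\<^sub>M borel)"
    unfolding sets_\<nu> borel_prod ..
  have space_\<nu>: "space \<nu> = UNIV"
    using sets_eq_imp_space_eq[OF sets_\<nu>] by simp
  have [measurable]: "cell r N \<in> borel \<rightarrow>\<^sub>M count_space UNIV"
    unfolding cell_def by measurable
  define code where "code z = grid_state (cell r N (fst z)) (cell r N (snd z))" for z :: "real \<times> real"
  have code[measurable]: "code \<in> \<nu> \<rightarrow>\<^sub>M count_space UNIV"
    unfolding code_def by measurable
  have code_in: "code z \<in> grid N" for z
    by (auto simp: code_def grid_def cell_def intro!: image_eqI[of _ _ "(cell r N (fst z), cell r N (snd z))"])
  define D where "D = distr \<nu> (count_space UNIV) code"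
  have measure_D: "measure D {k. P k} = measure \<nu> {z. P (code z)}" for P
    unfolding D_def by (subst measure_distr) (auto simp: space_\<nu> vimage_def)
  interpret common_shock "grid N" 0 l r D
  proof (rule common_shock.intro)
    show "prob_space D" unfolding D_def by (rule \<nu>.prob_space_distr) simp
    show "AE k in D. k \<in> grid N"
      unfolding D_def by (subst AE_distr_iff) (auto simp: code_in)
  qed (auto simp: D_def grid_def grid_state_def l r)
  have H: "phase1 k \<le> N" "phase2 k \<le> N" if "k \<in> grid N" for k
    using that by (auto simp: grid_def)
  obtain \<mu> where csph: "csph_distribution a1 a2 \<mu>"
    and upper: "\<And>x y \<delta>. 0 < \<delta> \<Longrightarrow>
      bivariate_cdf \<mu> (x, y) \<le>
        measure D {k. real (phase1 k + 1) / r \<le> x + \<delta> \<and> real (phase2 k + 1) / r \<le> y + \<delta>}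
          + 2 * real (N + 1) / (r * \<delta>)\<^sup>2"
    and lower: "\<And>x y \<delta>. 0 < \<delta> \<Longrightarrow>
      measure D {k. real (phase1 k + 1) / r \<le> x - 2 * \<delta> \<and> real (phase2 k + 1) / r \<le> y - 2 * \<delta>}
        \<le> bivariate_cdf \<mu> (x, y) + 2 * real (N + 1) / (r * \<delta>)\<^sup>2 + exp (- (\<delta> / max a1 a2) * l)"
    using csph_near_grid_law[OF countdown_grid[OF r] a H] by blast
  let ?W = "\<lambda>x y. {z. real (cell r N (fst z) + 1) / r \<le> x \<and> real (cell r N (snd z) + 1) / r \<le> y}"
  have D_W: "measure D {k. real (phase1 k + 1) / r \<le> x \<and> real (phase2 k + 1) / r \<le> y} = measure \<nu> (?W x y)" for x y
    by (subst measure_D) (simp add: code_def)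
  have "{z \<in> space \<nu>. real (cell r N (fst z) + 1) / r \<le> x \<and> real (cell r N (snd z) + 1) / r \<le> y} \<in> sets \<nu>" for x y
    by measurable
  then have ev_W: "?W x y \<in> sets \<nu>" for x y
    by (simp add: space_\<nu>)
  have ev_Q: "{..x} \<times> {..y} \<in> sets \<nu>" for x y :: real
    by measurable
  show thesis
  proof (rule that[OF csph])
    fix x y \<delta> :: real
    assume \<delta>: "0 < \<delta>" and xy: "(x + \<delta>) * r < N" "(y + \<delta>) * r < N"
    have "?W (x + \<delta>) (y + \<delta>) \<subseteq> {..x + \<delta>} \<times> {..y + \<delta>}"
      using cell_lower[OF r _ xy(1)] cell_lower[OF r _ xy(2)] by auto
    then have "measure \<nu> (?W (x + \<delta>) (y + \<delta>)) \<le> bivariate_cdf \<nu> (x + \<delta>, y + \<delta>)"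
      unfolding bivariate_cdf_def using ev_Q by (simp add: \<nu>.finite_measure_mono)
    then show "bivariate_cdf \<mu> (x, y) \<le> bivariate_cdf \<nu> (x + \<delta>, y + \<delta>) + 2 * real (N + 1) / (r * \<delta>)\<^sup>2"
      using upper[OF \<delta>, of x y] unfolding D_W by linarith
  next
    fix x y \<delta> :: real
    assume \<delta>: "1 / r \<le> \<delta>"
    have "0 < 1 / r" using r by simp
    then have \<delta>_pos: "0 < \<delta>" using \<delta> by linarith
    have "AE z in \<nu>. z \<in> {..x - 3 * \<delta>} \<times> {..y - 3 * \<delta>} \<longrightarrow> z \<in> ?W (x - 2 * \<delta>) (y - 2 * \<delta>)"
      using quadrant
    proof eventually_elim
      fix z :: "real \<times> real" assume z: "z \<in> {0..} \<times> {0..}"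
      show "z \<in> {..x - 3 * \<delta>} \<times> {..y - 3 * \<delta>} \<longrightarrow> z \<in> ?W (x - 2 * \<delta>) (y - 2 * \<delta>)"
      proof
        assume z': "z \<in> {..x - 3 * \<delta>} \<times> {..y - 3 * \<delta>}"
        have "0 \<le> fst z" "0 \<le> snd z" "fst z \<le> x - 2 * \<delta> - 1 / r" "snd z \<le> y - 2 * \<delta> - 1 / r"
          using z z' \<delta> by (auto simp: mem_Times_iff)
        then show "z \<in> ?W (x - 2 * \<delta>) (y - 2 * \<delta>)"
          using cell_upper[OF r] by blast
      qed
    qed
    then have "bivariate_cdf \<nu> (x - 3 * \<delta>, y - 3 * \<delta>) \<le> measure \<nu> (?W (x - 2 * \<delta>) (y - 2 * \<delta>))"
      unfolding bivariate_cdf_def using ev_W by (simp add: \<nu>.finite_measure_mono_AE)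
    then show "bivariate_cdf \<nu> (x - 3 * \<delta>, y - 3 * \<delta>)
        \<le> bivariate_cdf \<mu> (x, y) + 2 * real (N + 1) / (r * \<delta>)\<^sup>2 + exp (- (\<delta> / max a1 a2) * l)"
      using lower[OF \<delta>_pos, of x y] unfolding D_W by linarith
  qed
qed

text \<open>Continuity at \<open>(x, y)\<close> makes the values of \<open>F\<close> at the diagonally shifted points
  close to \<open>F (x, y)\<close>; the shift is chosen first, and \<open>n\<close> afterwards so large that the error
  for this shift is small.\<close>
lemma tendsto_diagonal_sandwich:
  fixes F :: "real \<times> real \<Rightarrow> real" and Fs :: "nat \<Rightarrow> real"
  assumes cont: "isCont F (x, y)"
    and err: "\<And>\<delta>. 0 < \<delta> \<Longrightarrow> (err \<delta>) \<longlonglongrightarrow> 0"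
    and upper: "\<And>\<delta>. 0 < \<delta> \<Longrightarrow> \<forall>\<^sub>F n in sequentially. Fs n \<le> F (x + \<delta>, y + \<delta>) + err \<delta> n"
    and lower: "\<And>\<delta>. 0 < \<delta> \<Longrightarrow> \<forall>\<^sub>F n in sequentially. F (x - 3 * \<delta>, y - 3 * \<delta>) \<le> Fs n + err \<delta> n"
  shows "Fs \<longlonglongrightarrow> F (x, y)"
proof (rule tendstoI)
  fix \<epsilon> :: real assume "0 < \<epsilon>"
  then obtain d where d: "0 < d" "\<And>z. dist z (x, y) < d \<Longrightarrow> dist (F z) (F (x, y)) < \<epsilon> / 2"
    using cont unfolding continuous_at_eps_delta by (metis half_gt_zero)
  \<comment> \<open>The largest shift, by \<open>3 \<delta>\<close> in both coordinates, has norm at most \<open>6 \<delta>\<close>, below \<open>d\<close>.\<close>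
  define \<delta> where "\<delta> = d / 7"
  have \<delta>: "0 < \<delta>" using d by (simp add: \<delta>_def)
  have diag: "dist (x + t, y + t) (x, y) < d" if "\<bar>t\<bar> \<le> 3 * \<delta>" for t
  proof -
    have "dist (x + t, y + t) (x, y) = norm (t, t)" by (simp add: dist_norm)
    also have "\<dots> \<le> norm t + norm t" by (rule norm_Pair_le)
    also have "\<dots> < d" using that d by (simp add: \<delta>_def)
    finally show ?thesis .
  qed
  have up: "F (x + \<delta>, y + \<delta>) < F (x, y) + \<epsilon> / 2"
    using d(2)[OF diag, of \<delta>] \<delta> unfolding dist_real_def abs_less_iff by simp
  have lo: "F (x, y) - \<epsilon> / 2 < F (x - 3 * \<delta>, y - 3 * \<delta>)"
    using d(2)[OF diag, of "- 3 * \<delta>"] \<delta> unfolding dist_real_def abs_less_iff by simp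
  have "\<forall>\<^sub>F n in sequentially. err \<delta> n < \<epsilon> / 2"
    using err[OF \<delta>] \<open>0 < \<epsilon>\<close> by (intro order_tendstoD) auto
  with upper[OF \<delta>] lower[OF \<delta>] show "\<forall>\<^sub>F n in sequentially. dist (Fs n) (F (x, y)) < \<epsilon>"
  proof eventually_elim
    case (elim n)
    then show ?case using up lo by (simp add: dist_real_def abs_less_iff)
  qed
qed

theorem theorem5p1:
  fixes F :: "real \<times> real \<Rightarrow> real" and \<nu> :: "(real \<times> real) measure" and a1 a2 :: real
  assumes "prob_space \<nu>" and "sets \<nu> = sets borel"
    and "F = bivariate_cdf \<nu>"
    and "support \<nu> \<subseteq> {0..} \<times> {0..}"
    and "0 < a1" and "0 < a2"
  shows "\<exists>\<mu> :: nat \<Rightarrow> (real \<times> real) measure.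
           (\<forall>n. csph_distribution a1 a2 (\<mu> n)) \<and>
           bivariate_weak_conv (\<lambda>n. bivariate_cdf (\<mu> n)) F"
proof -
  have "AE z in \<nu>. z \<in> support \<nu>"
    using assms(1,2) by (intro AE_in_support prob_space.finite_measure)
  then have quadrant: "AE z in \<nu>. z \<in> {0..} \<times> {0..}"
    by eventually_elim (use assms(4) in blast)
  define r where "r n = (real n + 1)\<^sup>2" for n
  define N where "N n = (n + 1) ^ 3" for n :: nat
  define err where "err \<delta> n = 2 * real (N n + 1) / (r n * \<delta>)\<^sup>2 + exp (- (\<delta> / max a1 a2) * (real n + 1))" for \<delta> n
  have "\<exists>\<mu>. csph_distribution a1 a2 \<mu> \<and>
      (\<forall>x y \<delta>. 0 < \<delta> \<longrightarrow> (x + \<delta>) * r n < N n \<longrightarrow> (y + \<delta>) * r n < N n \<longrightarrow>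
        bivariate_cdf \<mu> (x, y) \<le> F (x + \<delta>, y + \<delta>) + err \<delta> n) \<and>
      (\<forall>x y \<delta>. 1 / r n \<le> \<delta> \<longrightarrow> F (x - 3 * \<delta>, y - 3 * \<delta>) \<le> bivariate_cdf \<mu> (x, y) + err \<delta> n)" for n
  proof -
    have "0 < real n + 1" "0 < r n" by (auto simp: r_def)
    then obtain \<mu> where "csph_distribution a1 a2 \<mu>"
      and "\<And>x y \<delta>. 0 < \<delta> \<Longrightarrow> (x + \<delta>) * r n < N n \<Longrightarrow> (y + \<delta>) * r n < N n \<Longrightarrow>
        bivariate_cdf \<mu> (x, y) \<le> F (x + \<delta>, y + \<delta>) + 2 * real (N n + 1) / (r n * \<delta>)\<^sup>2"
      and "\<And>x y \<delta>. 1 / r n \<le> \<delta> \<Longrightarrow> F (x - 3 * \<delta>, y - 3 * \<delta>)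
        \<le> bivariate_cdf \<mu> (x, y) + 2 * real (N n + 1) / (r n * \<delta>)\<^sup>2 + exp (- (\<delta> / max a1 a2) * (real n + 1))"
      using csph_approximation[OF assms(1,2) quadrant assms(5,6)] unfolding assms(3) by metis
    then show ?thesis
      unfolding err_def by (intro exI[of _ \<mu>]) (auto simp: add.assoc[symmetric] intro: add_increasing2)
  qed
  then obtain \<mu> where csph: "\<And>n. csph_distribution a1 a2 (\<mu> n)"
    and upper: "\<And>n x y \<delta>. 0 < \<delta> \<Longrightarrow> (x + \<delta>) * r n < N n \<Longrightarrow> (y + \<delta>) * r n < N n \<Longrightarrow>
        bivariate_cdf (\<mu> n) (x, y) \<le> F (x + \<delta>, y + \<delta>) + err \<delta> n"
    and lower: "\<And>n x y \<delta>. 1 / r n \<le> \<delta> \<Longrightarrow> F (x - 3 * \<delta>, y - 3 * \<delta>) \<le> bivariate_cdf (\<mu> n) (x, y) + err \<delta> n"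
    by metis
  have err: "err \<delta> \<longlonglongrightarrow> 0" if "0 < \<delta>" for \<delta>
  proof -
    define c where "c = \<delta> / max a1 a2"
    have "0 < c" using that assms(5) by (simp add: c_def)
    then show ?thesis
      unfolding err_def[abs_def] c_def[symmetric] r_def N_def using that by real_asymp
  qed
  have "(\<lambda>n. bivariate_cdf (\<mu> n) (x, y)) \<longlonglongrightarrow> F (x, y)" if "isCont F (x, y)" for x y
  proof (rule tendsto_diagonal_sandwich[OF that err])
    fix \<delta> :: real assume \<delta>: "0 < \<delta>"
    have "\<forall>\<^sub>F n in sequentially. (c + \<delta>) * r n < N n" for c
      unfolding r_def N_def by real_asymp
    from this[of x] this[of y] show "\<forall>\<^sub>F n in sequentially. bivariate_cdf (\<mu> n) (x, y) \<le> F (x + \<delta>, y + \<delta>) + err \<delta> n"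
      by eventually_elim (rule upper[OF \<delta>])
    have "\<forall>\<^sub>F n in sequentially. 1 / r n \<le> \<delta>"
      unfolding r_def using \<delta> by real_asymp
    then show "\<forall>\<^sub>F n in sequentially. F (x - 3 * \<delta>, y - 3 * \<delta>) \<le> bivariate_cdf (\<mu> n) (x, y) + err \<delta> n"
      by eventually_elim (rule lower)
  qed
  then show ?thesis
    using csph unfolding bivariate_weak_conv_def by auto
qed

end
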